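(* Let $n\ge 1$, let $(\alpha_{2i})_{1\le i\le n}$ with $\alpha_{2i}\in\{0,1\}^{i-1}$ be any parameter sequence, and let $\mathcal{P}_{2n}(n,n+1)$ and $\mathcal{C}_{2n+1}$ be the family of paths and the 2-factor of $Q_{2n+1}(n,n+1)$ obtained from the construction described in the context. For any cycle in $\mathcal{C}_{2n+1}$, the distance (along the cycle) between any two neighboring vertices of the form $F(P)\circ(0)$, $F(P')\circ(0)$ with $P,P'\in\mathcal{P}_{2n}(n,n+1)$ on the cycle equals $4n+2$. Consequently, for any cycle $C\in\mathcal{C}_{2n+1}$ we have $$e(C)=(4n+2)\cdot\big|\{P\in\mathcal{P}_{2n}(n,n+1)\mid F(P)\circ(0)\in C\}\big|.$$ In particular, the length of all cycles in $\mathcal{C}_{2n+1}$ is a multiple of $4n+2$, and the length of a shortest cycle is at least $4n+2$.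
   Context: $e(G)$ denotes the number of edges of a graph $G$. On a cycle $C$ of $\mathcal{C}_{2n+1}$, two vertices of the form $F(P)\circ(0)$, $F(P')\circ(0)$ are neighboring if one is the next vertex of this form after the other when traversing $C$; the distance is the number of edges traversed in between. If $C$ contains only one vertex of this form, then $P'=P$ and the distance is that of one full traversal of $C$. Bitstrings and layers. $B_n=\{0,1\}^n$, and $B_n(k)\subseteq B_n$ is the set of bitstrings with exactly $k$ entries equal to 1. For $0\le k\le n-1$, $Q_n(k,k+1)$ is the graph with vertex set $B_n(k)\cup B_n(k+1)$ in which two vertices are adjacent iff they differ in exactly one bit. $x\circ y$ denotes concatenation of bitstrings; for a graph, path, set of bitstrings, or family of graphs/paths $X$, $X\circ y$ is obtained by appending $y$ to every bitstring (vertex) involved. $\overline{x}$ is the bitwise complement of $x$, and $\mathrm{rev}(x)$ is the reversed bitstring. A 2-factor of a graph is a 2-regular spanning subgraph, also regarded as the set of its cycles. For an oriented path $P=(v_1,\ldots,v_l)$ let $F(P)=v_1$, $S(P)=v_2$, $L(P)=v_l$; for a family $\mathcal{P}$ of oriented paths, $F(\mathcal{P})=\{F(P)\mid P\in\mathcal{P}\}$, and similarly $S(\mathcal{P})$, $L(\mathcal{P})$. Maps $f_\alpha$. For $\alpha\in\{0,1\}^{n-1}$, $\pi_\alpha:B_{2n}\to B_{2n}$ swaps the bits at positions $2i$ and $2i+1$ for exactly those $i\in\{1,\ldots,n-1\}$ with $\alpha(i)=1$, leaving everything else unchanged; $f_\alpha(x):=\overline{\mathrm{rev}(\pi_\alpha(x))}$.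 It is applied to paths vertex by vertex and is an isomorphism from $Q_{2n}(n,n+1)$ to $Q_{2n}(n-1,n)$. Construction. Given parameters $\alpha_{2i}\in\{0,1\}^{i-1}$, define families of pairwise disjoint oriented paths $\mathcal{P}_{2n}(k,k+1)$ in $Q_{2n}(k,k+1)$, $k=n,\ldots,2n-1$, starting and ending in $B_{2n}(k)$ (depending on $\alpha_2,\ldots,\alpha_{2n-2}$), and 2-factors $\mathcal{C}_{2n+1}$ of $Q_{2n+1}(n,n+1)$ (depending on $\alpha_2,\ldots,\alpha_{2n}$). Base: $\mathcal{P}_2(1,2):=\{((1,0),(1,1),(0,1))\}$. 2-factor $\mathcal{C}_{2n+1}$: let $M_{2n+1}^{FL}$ be the set of edges $\{v\circ(0),v\circ(1)\}$ with $v\in F(\mathcal{P}_{2n}(n,n+1))\cup L(\mathcal{P}_{2n}(n,n+1))$, and let $$\mathcal{C}_{2n+1}:=\mathcal{P}_{2n}(n,n+1)\circ(0)\;\cup\; f_{\alpha_{2n}}(\mathcal{P}_{2n}(n,n+1))\circ(1)\;\cup\; M_{2n+1}^{FL}.$$ This is a 2-factor of $Q_{2n+1}(n,n+1)$, because the paths in $\mathcal{P}_{2n}(n,n+1)$ visit all vertices of $Q_{2n}(n,n+1)$ and $f_{\alpha_{2n}}$ maps each of $F(\mathcal{P}_{2n}(n,n+1))$ and $L(\mathcal{P}_{2n}(n,n+1))$ onto itself. Step $n\to n+1$: with the conventions $\mathcal{P}_{2n}(2n,2n+1):=\mathcal{P}_{2n}(2n+1,2n+2):=\emptyset$, for $k=n+2,\ldots,2n+1$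 let $$\mathcal{P}_{2n+2}(k,k+1):=\mathcal{P}_{2n}(k,k+1)\circ(0,0)\cup\mathcal{P}_{2n}(k-1,k)\circ(1,0)\cup\mathcal{P}_{2n}(k-1,k)\circ(0,1)\cup\mathcal{P}_{2n}(k-2,k-1)\circ(1,1).$$ Let $\mathcal{C}_{2n+1}^-$ be obtained from $\mathcal{C}_{2n+1}$ by deleting every edge $(F(P),S(P))\circ(0)$, $P\in\mathcal{P}_{2n}(n,n+1)$; its components are paths, each joining a vertex $S(P)\circ(0)$ to a vertex $F(P')\circ(0)$ for some $P,P'\in\mathcal{P}_{2n}(n,n+1)$. Let $M_{2n+2}^S$ be the set of edges $\{s\circ(0,0),s\circ(0,1)\}$ with $s\in S(\mathcal{P}_{2n}(n,n+1))$. Let $\mathcal{P}'_{2n+2}$ be the set of components of $M_{2n+2}^S\cup\mathcal{C}_{2n+1}^-\circ(1)$, which are paths, each oriented so that its first edge is its edge from $M_{2n+2}^S$ (directed from $s\circ(0,0)$ to $s\circ(0,1)$). Finally $$\mathcal{P}_{2n+2}(n+1,n+2):=\mathcal{P}_{2n}(n+1,n+2)\circ(0,0)\cup\mathcal{P}_{2n}(n,n+1)\circ(1,0)\cup\mathcal{P}'_{2n+2}.$$ *)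

theory Defs
  imports Main
begin

type_synonym bitstring = "bool list"

text \<open>A graph is given by a vertex set and a set of two-element edges; a subgraph without
  isolated vertices is given by its edge set alone. An oriented path is the list of the vertices it visits.\<close>

definition layer :: "nat \<Rightarrow> nat \<Rightarrow> bitstring set" where
  "layer n k = {x. length x = n \<and> card {i. i < n \<and> x ! i} = k}"

definition cube_vertices :: "nat \<Rightarrow> nat \<Rightarrow> bitstring set" where
  "cube_vertices n k = layer n k \<union> layer n (k + 1)"

definition cube_edges :: "nat \<Rightarrow> nat \<Rightarrow> bitstring set set" where
  "cube_edges n k = {{x, y} | x y. x \<in> cube_vertices n k \<and> y \<in> cube_vertices n k \<and>
     card {i. i < n \<and> x ! i \<noteq> y ! i} = 1}"

definition two_factor :: "'a set \<Rightarrow> 'a set set \<Rightarrow> 'a set set \<Rightarrow> bool" where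
  "two_factor V E C \<longleftrightarrow> C \<subseteq> E \<and> (\<forall>v\<in>V. card {e \<in> C. v \<in> e} = 2)"

definition path_edges :: "'a list \<Rightarrow> 'a set set" where
  "path_edges p = {{p ! i, p ! (i + 1)} | i. i + 1 < length p}"

definition component :: "'a set set \<Rightarrow> 'a \<Rightarrow> 'a set set" where
  "component E v = {e \<in> E. \<exists>u\<in>e. (v, u) \<in> {(x, y). {x, y} \<in> E}\<^sup>*}"

definition components :: "'a set set \<Rightarrow> 'a set set set" where
  "components E = component E ` \<Union>E"

text \<open>Cycles are edge sets; \<open>traverses c C\<close> says that listing the vertices of \<open>c\<close> and
  returning to the first one is a full traversal of \<open>C\<close>, in either direction and from any start.\<close>

definition traverses :: "'a list \<Rightarrow> 'a set set \<Rightarrow> bool" where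
  "traverses c C \<longleftrightarrow> 3 \<le> length c \<and> distinct c \<and>
     C = {{c ! i, c ! ((i + 1) mod length c)} | i. i < length c}"

definition cycles :: "'a set set \<Rightarrow> 'a set set set" where
  "cycles E = {C. C \<subseteq> E \<and> (\<exists>c. traverses c C)}"

text \<open>Starting at position \<open>i\<close> of the cyclic list \<open>c\<close>, on a vertex of \<open>X\<close>, the next vertex of \<open>X\<close>
  is met after \<open>d\<close> edges. If \<open>X\<close> contains no other vertex of \<open>c\<close>, then \<open>d = length c\<close>.\<close>

definition next_at_distance :: "'a set \<Rightarrow> 'a list \<Rightarrow> nat \<Rightarrow> nat \<Rightarrow> bool" where
  "next_at_distance X c i d \<longleftrightarrow> i < length c \<and> 0 < d \<and>
     c ! i \<in> X \<and> c ! ((i + d) mod length c) \<in> X \<and>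
     (\<forall>j. 0 < j \<and> j < d \<longrightarrow> c ! ((i + j) mod length c) \<notin> X)"

definition append_vertex :: "bitstring \<Rightarrow> bitstring \<Rightarrow> bitstring" where
  "append_vertex y v = v @ y"

definition append_paths :: "bitstring list set \<Rightarrow> bitstring \<Rightarrow> bitstring list set" where
  "append_paths \<P> y = map (append_vertex y) ` \<P>"

definition append_edges :: "bitstring set set \<Rightarrow> bitstring \<Rightarrow> bitstring set set" where
  "append_edges E y = (`) (append_vertex y) ` E"

fun swap_pairs :: "bool list \<Rightarrow> bitstring \<Rightarrow> bitstring" where
  "swap_pairs (a # as) (x # y # xs) = (if a then y # x # swap_pairs as xs else x # y # swap_pairs as xs)"
| "swap_pairs as xs = xs"

text \<open>The first bit stays in place, so the \<open>i\<close>-th pair to be swapped (counting from 1)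
  consists of the positions \<open>2 * i\<close> and \<open>2 * i + 1\<close> (counting from 1).\<close>

fun perm_pi :: "bool list \<Rightarrow> bitstring \<Rightarrow> bitstring" where
  "perm_pi \<alpha> [] = []"
| "perm_pi \<alpha> (x # xs) = x # swap_pairs \<alpha> xs"

definition map_f :: "bool list \<Rightarrow> bitstring \<Rightarrow> bitstring" where
  "map_f \<alpha> x = map Not (rev (perm_pi \<alpha> x))"

definition firsts :: "'a list set \<Rightarrow> 'a set" where
  "firsts \<P> = hd ` \<P>"

definition seconds :: "'a list set \<Rightarrow> 'a set" where
  "seconds \<P> = (\<lambda>p. p ! 1) ` \<P>"

definition lasts :: "'a list set \<Rightarrow> 'a set" where
  "lasts \<P> = last ` \<P>"

text \<open>In the next three definitions, \<open>\<P>\<close> is the family of paths in the \<open>2n\<close>-cube between the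
  layers \<open>n\<close> and \<open>n + 1\<close>, and \<open>a\<close> is the parameter with index \<open>2n\<close>.\<close>

definition build_factor :: "bool list \<Rightarrow> bitstring list set \<Rightarrow> bitstring set set" where
  "build_factor a \<P> =
     \<Union> (path_edges ` append_paths \<P> [False]) \<union>
     \<Union> (path_edges ` append_paths (map (map_f a) ` \<P>) [True]) \<union>
     {{v @ [False], v @ [True]} | v. v \<in> firsts \<P> \<union> lasts \<P>}"

definition build_factor_minus :: "bool list \<Rightarrow> bitstring list set \<Rightarrow> bitstring set set" where
  "build_factor_minus a \<P> = build_factor a \<P> - {{hd p @ [False], p ! 1 @ [False]} | p. p \<in> \<P>}"

definition build_new_paths :: "bool list \<Rightarrow> bitstring list set \<Rightarrow> bitstring list set" where
  "build_new_paths a \<P> = {p. distinct p \<and> 2 \<le> length p \<and>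
     path_edges p \<in> components
       ({{s @ [False, False], s @ [False, True]} | s. s \<in> seconds \<P>} \<union>
        append_edges (build_factor_minus a \<P>) [True]) \<and>
     (\<exists>s\<in>seconds \<P>. p ! 0 = s @ [False, False] \<and> p ! 1 = s @ [False, True])}"

text \<open>\<open>paths \<alpha> n k\<close> is the family of paths in the \<open>2n\<close>-cube between the layers \<open>k\<close> and \<open>k + 1\<close>,
  which is meant for \<open>1 \<le> n \<le> k \<le> 2 * n - 1\<close>. It is empty for all other values of \<open>k\<close>; the recursion
  relies on this for \<open>k = 2 * n\<close> and \<open>k = 2 * n + 1\<close>.\<close>

fun paths :: "(nat \<Rightarrow> bool list) \<Rightarrow> nat \<Rightarrow> nat \<Rightarrow> bitstring list set" where
  "paths \<alpha> 0 k = {}"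
| "paths \<alpha> (Suc 0) k = (if k = 1 then {[[True, False], [True, True], [False, True]]} else {})"
| "paths \<alpha> (Suc (Suc m)) k = (let n = Suc m in
     if n + 2 \<le> k \<and> k \<le> 2 * n + 1 then
       append_paths (paths \<alpha> (Suc m) k) [False, False] \<union>
       append_paths (paths \<alpha> (Suc m) (k - 1)) [True, False] \<union>
       append_paths (paths \<alpha> (Suc m) (k - 1)) [False, True] \<union>
       append_paths (paths \<alpha> (Suc m) (k - 2)) [True, True]
     else if k = n + 1 then
       append_paths (paths \<alpha> (Suc m) (n + 1)) [False, False] \<union>
       append_paths (paths \<alpha> (Suc m) n) [True, False] \<union>
       build_new_paths (\<alpha> (2 * n)) (paths \<alpha> (Suc m) n)
     else {})"

definition factor :: "(nat \<Rightarrow> bool list) \<Rightarrow> nat \<Rightarrow> bitstring set set" where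
  "factor \<alpha> n = build_factor (\<alpha> (2 * n)) (paths \<alpha> n n)"

end

theory Submission
  imports Defs
begin

text \<open>Read a bitstring as a lattice path, with \<open>True\<close> an up-step and \<open>False\<close> a down-step. By induction
  on \<open>n\<close>, the first vertices of the paths are the nonnegative lattice paths that return to height 0, the
  second vertices are those that never return, and the last vertices are the lattice paths with exactly
  one down-step below height 0. Moreover, a path whose last vertex has its flaw at step \<open>2 * j + 1\<close>
  has \<open>4 * j + 2\<close> edges. The map \<open>map_f\<close> reflects lattice paths with \<open>2 * n\<close> steps that end at
  height 0, up to a change of the heights at even positions, so it sends a flaw with index \<open>j\<close> to one with
  index \<open>n - 1 - j\<close>. Hence a cycle that follows a path \<open>p\<close> and then an image \<open>map_f a\<close> of a path backwards
  uses \<open>(4 * j + 2) + (4 * (n - 1 - j) + 2) + 2 = 4 * n + 2\<close> edges from one first vertex to the next.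
  This is also the number of edges of each newly built path, whose last vertex is a nonnegative lattice
  path followed by a flaw of index \<open>n\<close>, so the induction continues.\<close>

section \<open>Graphs formed by cyclically linked walks\<close>

text \<open>Each string is a walk with \<open>N\<close> edges ending where the string chosen by
  \<open>\<tau>\<close> starts. As \<open>\<tau>\<close> permutes the strings, the walks close up to
  disjoint cycles made of whole strings, which forces all cycle lengths to be multiples of
  \<open>N\<close>.\<close>

locale necklace =
  fixes P :: "'p set" and w :: "'p \<Rightarrow> nat \<Rightarrow> 'v" and \<tau> :: "'p \<Rightarrow> 'p" and N :: nat
  assumes finite_strings: "finite P"
    and three_le: "3 \<le> N"
    and beads_inj: "\<lbrakk>p \<in> P; q \<in> P; i < N; j < N; w p i = w q j\<rbrakk> \<Longrightarrow> p = q \<and> i = j"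
    and link_surj: "\<tau> ` P = P"
    and link: "p \<in> P \<Longrightarrow> w p N = w (\<tau> p) 0"
begin

definition beads :: "'v set" where
  "beads = {w p j | p j. p \<in> P \<and> j < N}"

definition succ :: "'v \<Rightarrow> 'v" where
  "succ v = (THE u. \<exists>p\<in>P. \<exists>j<N. v = w p j \<and> u = w p (Suc j))"

definition edges :: "'v set set" where
  "edges = {{w p j, w p (Suc j)} | p j. p \<in> P \<and> j < N}"

lemma succ_bead: "\<lbrakk>p \<in> P; j < N\<rbrakk> \<Longrightarrow> succ (w p j) = w p (Suc j)"
  unfolding succ_def by (rule the_equality) (use beads_inj in blast)+

lemma beadE:
  assumes "v \<in> beads"
  obtains p j where "p \<in> P" "j < N" "v = w p j"
  using assms by (auto simp: beads_def)

lemma bead_in: "\<lbrakk>p \<in> P; j \<le> N\<rbrakk> \<Longrightarrow> w p j \<in> beads"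
proof (cases "j = N")
  case True
  assume "p \<in> P"
  then have "w p j = w (\<tau> p) 0" "\<tau> p \<in> P" "0 < N" using True link link_surj three_le by auto
  then show ?thesis unfolding beads_def by blast
next
  case False
  assume "p \<in> P" "j \<le> N"
  with False show ?thesis by (auto simp: beads_def intro!: exI[of _ p] exI[of _ j])
qed

lemma finite_beads: "finite beads"
proof -
  have "beads = (\<lambda>(p, j). w p j) ` (P \<times> {..<N})" by (auto simp: beads_def)
  then show ?thesis using finite_strings by simp
qed

lemma succ_surj: "succ ` beads = beads"
proof
  show "succ ` beads \<subseteq> beads"
    by (auto elim!: beadE simp: succ_bead bead_in)
  show "beads \<subseteq> succ ` beads"
  proof
    fix v assume "v \<in> beads"
    then obtain p j where pj: "p \<in> P" "j < N" "v = w p j" by (rule beadE)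
    show "v \<in> succ ` beads"
    proof (cases j)
      case 0
      from pj link_surj obtain q where q: "q \<in> P" "p = \<tau> q" by blast
      then have "succ (w q (N - 1)) = v"
        using succ_bead[of q "N - 1"] link[of q] three_le pj 0 by simp
      then show ?thesis using bead_in[of q "N - 1"] q by force
    next
      case (Suc i)
      then show ?thesis using pj succ_bead[of p i] bead_in[of p i] by force
    qed
  qed
qed

text \<open>A surjection of a finite set onto itself is injective, so each bead has exactly one
  predecessor.\<close>

lemma succ_inj: "inj_on succ beads"
  using finite_beads succ_surj by (simp add: eq_card_imp_inj_on)

lemma succ_in: "v \<in> beads \<Longrightarrow> succ v \<in> beads"
  using succ_surj by blast

text \<open>Two steps cross at most one link, and \<open>3 \<le> N\<close> keeps the positions
  reached apart from \<open>j\<close>, even if \<open>\<tau> p = p\<close>. So there are neither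
  loops nor doubled edges.\<close>

lemma succ_succ_neq:
  assumes "v \<in> beads"
  shows "succ (succ v) \<noteq> v" "succ v \<noteq> v"
proof -
  from assms obtain p j where pj: "p \<in> P" "j < N" "v = w p j" by (rule beadE)
  have t: "\<tau> p \<in> P" using link_surj pj by blast
  consider "Suc (Suc j) < N" | "Suc (Suc j) = N" | "Suc j = N" using pj by linarith
  then have "succ (succ v) \<noteq> v \<and> succ v \<noteq> v"
  proof cases
    case 1
    then show ?thesis using pj beads_inj[of p p "Suc (Suc j)" j] beads_inj[of p p "Suc j" j]
      by (auto simp: succ_bead)
  next
    case 2
    then show ?thesis using pj t three_le link[of p] beads_inj[of "\<tau> p" p 0 j] beads_inj[of p p "Suc j" j]
      by (auto simp: succ_bead)
  next
    case 3
    then show ?thesis using pj t three_le link[of p] succ_bead[of "\<tau> p" 0]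
        beads_inj[of "\<tau> p" p 1 j] beads_inj[of "\<tau> p" p 0 j]
      by (auto simp: succ_bead)
  qed
  then show "succ (succ v) \<noteq> v" "succ v \<noteq> v" by auto
qed

lemma edges_succ: "edges = (\<lambda>v. {v, succ v}) ` beads"
  unfolding edges_def beads_def using succ_bead by (fastforce simp del: insert_iff)

lemma edge_cases:
  assumes "{x, y} \<in> edges"
  shows "x \<in> beads" "y \<in> beads" "y = succ x \<or> x = succ y"
  using assms succ_in by (auto simp: edges_succ doubleton_eq_iff)

lemma edge_inj: "inj_on (\<lambda>v. {v, succ v}) beads"
  by (rule inj_onI) (metis doubleton_eq_iff succ_succ_neq(1))

lemma degree_two:
  assumes "v \<in> beads"
  shows "card {e \<in> edges. v \<in> e} = 2"
proof -
  from assms succ_surj obtain u where u: "u \<in> beads" "v = succ u" by blast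
  have "{e \<in> edges. v \<in> e} = {{v, succ v}, {u, v}}"
    using assms u inj_onD[OF succ_inj] by (auto simp: edges_succ)
  moreover have "{v, succ v} \<noteq> {u, v}"
    using succ_succ_neq[OF u(1)] u by (auto simp: doubleton_eq_iff)
  ultimately show ?thesis by simp
qed

text \<open>An edge determines its position \<open>(p, j)\<close> by \<open>edge_inj\<close>, so
  deleting the edges at position 0 deletes no others. This is the cut that opens the cycles for the
  new paths.\<close>

lemma edges_minus_first:
  "edges - {{w p 0, w p (Suc 0)} | p. p \<in> P} = {{w p (Suc j), w p (Suc (Suc j))} | p j. p \<in> P \<and> Suc j < N}"
  (is "?L = ?R")
proof -
  have eq: "p = q \<and> i = j"
    if "p \<in> P" "q \<in> P" "i < N" "j < N" "{w p i, w p (Suc i)} = {w q j, w q (Suc j)}" for p q i j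
    using inj_onD[OF edge_inj, of "w p i" "w q j"] that beads_inj[of p q i j]
    by (auto simp: succ_bead bead_in)
  show ?thesis
  proof
    show "?L \<subseteq> ?R"
    proof
      fix e assume e: "e \<in> ?L"
      then obtain p j where "p \<in> P" "j < N" "e = {w p j, w p (Suc j)}"
        unfolding edges_def by blast
      with e show "e \<in> ?R" by (cases j) auto
    qed
    show "?R \<subseteq> ?L"
    proof
      fix e assume "e \<in> ?R"
      then obtain p j where *: "p \<in> P" "Suc j < N" "e = {w p (Suc j), w p (Suc (Suc j))}"
        by blast
      have "e \<noteq> {w q 0, w q (Suc 0)}" if "q \<in> P" for q
        using eq[of p q "Suc j" 0] * that three_le by auto
      with * show "e \<in> ?L" unfolding edges_def by blast
    qed
  qed
qed

text \<open>Shifted by the injective \<open>succ\<close>, the positions 1 to \<open>N\<close> name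
  the beads uniquely as well. This makes the cut-open strings disjoint.\<close>

lemma tails_inj:
  "\<lbrakk>p \<in> P; q \<in> P; i < N; j < N; w p (Suc i) = w q (Suc j)\<rbrakk> \<Longrightarrow> p = q \<and> i = j"
  using inj_onD[OF succ_inj, of "w p i" "w q j"] beads_inj[of p q i j]
  by (auto simp: succ_bead bead_in)

lemma succ_pow_bead: "\<lbrakk>p \<in> P; j \<le> N\<rbrakk> \<Longrightarrow> (succ ^^ j) (w p 0) = w p j"
  by (induction j) (auto simp: succ_bead)

text \<open>Following \<open>succ\<close> from a start, the positions 1 to \<open>N - 1\<close> come
  before the link leads to a start again.\<close>

lemma first_return:
  assumes "x \<in> {w p 0 | p. p \<in> P}" "0 < d" "(succ ^^ d) x \<in> {w p 0 | p. p \<in> P}"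
    "\<And>j. 0 < j \<Longrightarrow> j < d \<Longrightarrow> (succ ^^ j) x \<notin> {w p 0 | p. p \<in> P}"
  shows "d = N"
proof -
  from assms obtain p where p: "p \<in> P" "x = w p 0" by blast
  have N: "(succ ^^ N) x \<in> {w p 0 | p. p \<in> P}"
    using succ_pow_bead[of p N] link[of p] link_surj p by auto
  have early: "(succ ^^ j) x \<notin> {w p 0 | p. p \<in> P}" if "0 < j" "j < N" for j
  proof
    assume "(succ ^^ j) x \<in> {w p 0 | p. p \<in> P}"
    then obtain q where "q \<in> P" "w p j = w q 0"
      using succ_pow_bead[of p j] p \<open>j < N\<close> by auto
    then show False using beads_inj[of p q j 0] p that by simp
  qed
  show "d = N"
  proof (rule linorder_cases)
    assume "d < N"
    then show ?thesis using early[of d] assms(2,3) by blast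
  next
    assume "N < d"
    then show ?thesis using assms(4)[of N] N three_le by linarith
  qed
qed

section \<open>A single cycle of the graph\<close>

context
  fixes c C
  assumes trav: "traverses c C" and sub: "C \<subseteq> edges"
begin

definition at :: "nat \<Rightarrow> 'v" where "at i = c ! (i mod length c)"

lemma len: "3 \<le> length c" and dist: "distinct c"
  and C_eq: "C = {{at i, at (Suc i)} | i. i < length c}"
proof -
  show "3 \<le> length c" "distinct c" using trav by (auto simp: traverses_def)
  have "C = {{c ! i, c ! ((i + 1) mod length c)} | i. i < length c}"
    using trav by (auto simp: traverses_def)
  also have "\<dots> = {{at i, at (Suc i)} | i. i < length c}"
    by (rule Collect_cong, rule iff_exI) (auto simp: at_def)
  finally show "C = {{at i, at (Suc i)} | i. i < length c}" .
qed

lemma mod_len: "i mod length c < length c"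
  using len by (intro mod_less_divisor) linarith

lemma at_edge: "{at i, at (Suc i)} \<in> C"
proof -
  have "{at (i mod length c), at (Suc (i mod length c))} \<in> C"
    using mod_len unfolding C_eq by blast
  then show ?thesis by (simp add: at_def mod_Suc_eq)
qed

lemma at_step: "at (Suc i) = succ (at i) \<or> at i = succ (at (Suc i))"
  and at_bead: "at i \<in> beads"
  using at_edge[of i] sub edge_cases by blast+

text \<open>Since a cycle never turns back, its orientation along \<open>succ\<close> cannot change.\<close>

lemma at_nonback: "at (Suc (Suc i)) \<noteq> at i"
proof
  assume "at (Suc (Suc i)) = at i"
  then have "(i + 2) mod length c = (i + 0) mod length c"
    using nth_eq_iff_index_eq[OF dist mod_len mod_len] by (simp add: at_def)
  then have "length c dvd 2" using mod_eq_dvd_iff_nat[of i "i + 2" "length c"] by simp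
  with len dvd_imp_le[of "length c" 2] show False by simp
qed

text \<open>If the direction changed, the vertices on both sides of the turn would have the same
  successor and be equal by \<open>succ_inj\<close>, against \<open>at_nonback\<close>.\<close>

lemma forward: "at (Suc i) = succ (at i) \<Longrightarrow> at (i + j) = (succ ^^ j) (at i)
    \<and> at (Suc (i + j)) = succ (at (i + j))"
proof (induction j)
  case (Suc j)
  then show ?case
    using at_step[of "i + Suc j"] at_nonback[of "i + j"] inj_onD[OF succ_inj, OF _ at_bead at_bead]
    by (metis add_Suc_right funpow.simps(2) o_apply)
qed simp

text \<open>Here the vertices on both sides of a turn would both be the successor of the same
  vertex, again against \<open>at_nonback\<close>.\<close>

lemma backward: "at i = succ (at (Suc i)) \<Longrightarrow> (succ ^^ j) (at (i + j)) = at i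
    \<and> at (i + j) = succ (at (Suc (i + j)))"
proof (induction j)
  case (Suc j)
  then show ?case
    using at_step[of "i + Suc j"] at_nonback[of "i + j"]
    by (metis add_Suc_right funpow_Suc_right o_apply)
qed simp

lemma at_period: "at (i + length c) = at i"
  by (simp add: at_def)

lemma at_in: "at i \<in> set c"
  using mod_len by (simp add: at_def)

lemma in_at: "v \<in> set c \<Longrightarrow> \<exists>i. v = at i"
  by (metis at_def in_set_conv_nth mod_less)

lemma edge_succ: "v \<in> set c \<Longrightarrow> {v, succ v} \<in> C"
proof -
  assume "v \<in> set c"
  then obtain i where i: "v = at i" using in_at by blast
  show ?thesis
  proof (cases "at (Suc i) = succ (at i)")
    case True
    then show ?thesis using at_edge[of i] i by simp
  next
    case False
    \<comment> \<open>\<open>m\<close> indexes the edge entering \<open>at i\<close>. If the edge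
      leaving \<open>at i\<close> does not follow \<open>succ\<close>, neither does this one by
      \<open>forward\<close>, so it joins \<open>at i\<close> to its successor.\<close>
    define m where "m = i + length c - 1"
    have m: "Suc m = i + length c" using len by (simp add: m_def)
    have "at (Suc m) = at i" "at (Suc (Suc m)) = at (Suc i)"
      using at_period[of i] at_period[of "Suc i"] m by simp_all
    with False have "at (Suc m) \<noteq> succ (at m)"
      using forward[of m 1] by auto
    then have "at m = succ (at (Suc m))" using at_step by blast
    then show ?thesis using at_edge[of m] \<open>at (Suc m) = at i\<close> i by (simp add: insert_commute)
  qed
qed

lemma Union_cycle: "\<Union>C = set c"
proof
  show "\<Union>C \<subseteq> set c" unfolding C_eq using at_in by auto
  show "set c \<subseteq> \<Union>C" using in_at at_edge by blast
qed

lemma set_beads: "set c \<subseteq> beads"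
  using in_at at_bead by blast

lemma cycle_succ: "C = (\<lambda>v. {v, succ v}) ` set c"
proof
  show "C \<subseteq> (\<lambda>v. {v, succ v}) ` set c"
    unfolding C_eq using at_step at_in by (auto simp: image_iff) (metis insert_commute)
qed (use edge_succ in blast)

lemma succ_closed: "succ ` set c = set c"
proof (rule endo_inj_surj)
  show "succ ` set c \<subseteq> set c" using edge_succ Union_cycle by blast
  show "inj_on succ (set c)" using inj_on_subset[OF succ_inj set_beads] .
qed simp

text \<open>Injectivity of \<open>succ\<close> lets membership pass backwards too, so a cycle
  contains a string entirely or not at all.\<close>

lemma bead_cycle: "\<lbrakk>p \<in> P; j < N\<rbrakk> \<Longrightarrow> w p j \<in> set c \<longleftrightarrow> w p 0 \<in> set c"
proof (induction j)
  case (Suc j)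
  have "w p j \<in> set c \<longleftrightarrow> succ (w p j) \<in> set c"
  proof
    assume "succ (w p j) \<in> set c"
    then obtain v where "v \<in> set c" "succ (w p j) = succ v" using succ_closed by blast
    then show "w p j \<in> set c"
      using inj_onD[OF succ_inj, of "w p j" v] set_beads bead_in[of p j] Suc.prems by auto
  qed (use succ_closed in blast)
  then show ?case using Suc by (simp add: succ_bead)
qed simp

text \<open>A cycle has as many edges as vertices, and the vertices group into strings of
  \<open>N\<close> beads, one for each start on the cycle.\<close>

lemma card_cycle: "card C = N * card {p \<in> P. w p 0 \<in> \<Union>C}"
proof -
  have img: "set c = (\<lambda>(p, j). w p j) ` ({p \<in> P. w p 0 \<in> set c} \<times> {..<N})"
  proof (intro equalityI subsetI)
    fix v assume v: "v \<in> set c"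
    then obtain p j where "p \<in> P" "j < N" "v = w p j" using set_beads beadE by blast
    with v bead_cycle[of p j] show "v \<in> (\<lambda>(p, j). w p j) ` ({p \<in> P. w p 0 \<in> set c} \<times> {..<N})"
      by (intro image_eqI[of _ _ "(p, j)"]) auto
  qed (use bead_cycle in auto)
  have inj: "inj_on (\<lambda>(p, j). w p j) ({p \<in> P. w p 0 \<in> set c} \<times> {..<N})"
    using beads_inj by (auto simp: inj_on_def)
  have "card (set c) = card ({p \<in> P. w p 0 \<in> set c} \<times> {..<N})"
    by (rule trans[OF arg_cong[where f = card, OF img] card_image[OF inj]])
  then have "card (set c) = card {p \<in> P. w p 0 \<in> set c} * N"
    by (simp add: card_cartesian_product)
  moreover have "card C = card (set c)"
    unfolding cycle_succ using inj_on_subset[OF edge_inj set_beads] by (rule card_image)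
  ultimately show ?thesis by (simp add: Union_cycle)
qed

lemma cycle_pos: "0 < card C"
  using len unfolding cycle_succ by (auto simp: card_gt_0_iff)

lemma distance_eq:
  assumes "next_at_distance {w p 0 | p. p \<in> P} c i d"
  shows "d = N"
proof -
  let ?X = "{w p 0 | p. p \<in> P}"
  have a: "at i \<in> ?X" "0 < d" "at (i + d) \<in> ?X" "\<And>j. 0 < j \<Longrightarrow> j < d \<Longrightarrow> at (i + j) \<notin> ?X"
    using assms by (auto simp: next_at_distance_def at_def)
  show ?thesis
  proof (cases "at (Suc i) = succ (at i)")
    case True
    then have "(succ ^^ j) (at i) = at (i + j)" for j using forward by simp
    then show ?thesis by (intro first_return[OF a(1,2)]) (use a in simp_all)
  next
    case False
    then have b: "at i = succ (at (Suc i))" using at_step by blast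
    \<comment> \<open>A traversal against \<open>succ\<close> is read backwards, starting from
      position \<open>i + d\<close>.\<close>
    have pow: "(succ ^^ j) (at (i + d)) = at (i + (d - j))" if "j \<le> d" for j
    proof -
      have "at (i + (d - j)) = succ (at (Suc (i + (d - j))))" using backward[OF b] by blast
      then have "(succ ^^ j) (at (i + (d - j) + j)) = at (i + (d - j))" using backward by blast
      with that show ?thesis by simp
    qed
    show ?thesis
    proof (rule first_return[OF a(3,2)])
      show "(succ ^^ d) (at (i + d)) \<in> ?X" using a(1) pow[of d] by simp
      show "(succ ^^ j) (at (i + d)) \<notin> ?X" if "0 < j" "j < d" for j
        using a(4)[of "d - j"] pow[of j] that by simp
    qed
  qed
qed

end

end

section \<open>Edges of paths\<close>

lemma path_edges_simps [simp]:
  "path_edges [] = {}" "path_edges [x] = {}"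
  "path_edges (x # y # zs) = insert {x, y} (path_edges (y # zs))"
proof -
  show "path_edges (x # y # zs) = insert {x, y} (path_edges (y # zs))" (is "?L = ?R")
  proof
    show "?L \<subseteq> ?R"
    proof
      fix e assume "e \<in> ?L"
      then obtain i where "Suc i < length (x # y # zs)" "e = {(x # y # zs) ! i, (x # y # zs) ! Suc i}"
        by (auto simp: path_edges_def)
      then show "e \<in> ?R" by (cases i) (auto simp: path_edges_def)
    qed
    have "{x, y} \<in> ?L" by (force simp: path_edges_def)
    moreover have "path_edges (y # zs) \<subseteq> ?L"
    proof
      fix e assume "e \<in> path_edges (y # zs)"
      then obtain i where "Suc i < length (y # zs)" "e = {(y # zs) ! i, (y # zs) ! Suc i}"
        by (auto simp: path_edges_def)
      then show "e \<in> ?L" by (auto simp: path_edges_def intro!: exI[of _ "Suc i"])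
    qed
    ultimately show "?R \<subseteq> ?L" by blast
  qed
qed (auto simp: path_edges_def)

lemma path_edges_append:
  "xs \<noteq> [] \<Longrightarrow> ys \<noteq> [] \<Longrightarrow>
    path_edges (xs @ ys) = path_edges xs \<union> insert {last xs, hd ys} (path_edges ys)"
proof (induction xs rule: induct_list012)
  case (2 x)
  then show ?case by (cases ys) auto
qed auto

lemma path_edges_rev: "path_edges (rev xs) = path_edges xs"
proof (induction xs rule: induct_list012)
  case (3 x y zs)
  then show ?case
    using path_edges_append[of "rev (y # zs)" "[x]"] by (auto simp: last_rev insert_commute)
qed auto

lemma path_edges_map: "path_edges (map f xs) = (`) f ` path_edges xs"
  by (induction xs rule: induct_list012) auto

lemma path_edges_subset: "e \<in> path_edges xs \<Longrightarrow> e \<subseteq> set xs \<and> e \<noteq> {}"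
  by (auto simp: path_edges_def)

lemma Union_path_edges: "2 \<le> length xs \<Longrightarrow> \<Union>(path_edges xs) = set xs"
proof (induction xs rule: induct_list012)
  case (3 x y zs)
  then show ?case by (cases zs) auto
qed auto

text \<open>By distinctness only one edge meets the first vertex, so the edge set determines the
  second vertex, and induction does the rest.\<close>

lemma path_edges_inj:
  assumes "distinct p" "distinct q" "p \<noteq> []" "q \<noteq> []" "hd p = hd q" "path_edges p = path_edges q"
  shows "p = q"
  using assms
proof (induction p arbitrary: q rule: induct_list012)
  case (2 x)
  then show ?case by (cases q rule: remdups_adj.cases) auto
next
  case (3 x y zs)
  then obtain y' zs' where q: "q = x # y' # zs'"
    by (cases q rule: remdups_adj.cases) auto
  have fresh: "x \<notin> e" if "e \<in> path_edges (y # zs) \<union> path_edges (y' # zs')" for e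
    using 3(3,4) q that path_edges_subset[of e "y # zs"] path_edges_subset[of e "y' # zs'"] by auto
  have eq: "insert {x, y} (path_edges (y # zs)) = insert {x, y'} (path_edges (y' # zs'))"
    using 3 q by simp
  then have "{x, y} = {x, y'}" using fresh by (metis UnCI insertCI insertE insertI1)
  then have "y = y'" by (auto simp: doubleton_eq_iff)
  moreover from this eq fresh have "path_edges (y # zs) = path_edges (y' # zs')"
    by (metis UnCI insertI1 insert_ident)
  ultimately show ?case using 3(2)[of "y' # zs'"] 3(3,4) q by simp
qed auto

lemma successively_path_edges:
  assumes "successively R xs" "e \<in> path_edges xs"
  obtains x y where "x \<in> set xs" "y \<in> set xs" "R x y" "e = {x, y}"
  using assms
proof (induction xs arbitrary: thesis rule: induct_list012)
  case (3 x y zs)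
  show ?case
  proof (cases "e = {x, y}")
    case True
    then show ?thesis using 3 by (intro 3(3)[of x y]) auto
  next
    case False
    then show ?thesis using 3 by (metis insertE list.set_intros(2) path_edges_simps(3) successively.simps(3))
  qed
qed auto

text \<open>By disjointness an edge that meets a path belongs to it, so reachability never leaves
  the path. Inside the path all vertices are connected through the first one.\<close>

lemma component_path:
  assumes disj: "\<And>p q. p \<in> \<P> \<Longrightarrow> q \<in> \<P> \<Longrightarrow> set p \<inter> set q \<noteq> {} \<Longrightarrow> p = q"
    and p: "p \<in> \<P>" and v: "v \<in> set p"
  shows "component (\<Union> (path_edges ` \<P>)) v = path_edges p"
proof -
  let ?E = "\<Union> (path_edges ` \<P>)"
  let ?R = "{(x, y). {x, y} \<in> ?E}"
  have edge: "e \<in> path_edges p" if "e \<in> ?E" "u \<in> e" "u \<in> set p" for e u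
  proof -
    from that obtain q where q: "q \<in> \<P>" "e \<in> path_edges q" by blast
    with that path_edges_subset have "u \<in> set q" by blast
    with disj[OF p q(1)] that q show ?thesis by blast
  qed
  have stay: "u \<in> set p" if "(v, u) \<in> ?R\<^sup>*" for u
    using that
  proof (induction rule: rtrancl_induct)
    case (step y z)
    then have "{y, z} \<in> path_edges p" using edge[of "{y, z}" y] by blast
    then show ?case using path_edges_subset by blast
  qed (use v in simp)
  have step: "(p ! i, p ! Suc i) \<in> ?R" if "Suc i < length p" for i
    using p that unfolding path_edges_def by auto
  have up: "(p ! 0, p ! i) \<in> ?R\<^sup>*" if "i < length p" for i
    using that
  proof (induction i)
    case (Suc i)
    then show ?case using rtrancl_into_rtrancl[OF Suc.IH step[of i]] by simp
  qed simp
  have "sym ?R" by (auto simp: sym_def insert_commute)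
  then have down: "(p ! i, p ! 0) \<in> ?R\<^sup>*" if "i < length p" for i
    using up[OF that] by (meson sym_rtrancl symD)
  have reach: "(v, u) \<in> ?R\<^sup>*" if "u \<in> set p" for u
  proof -
    from v that obtain i j where "i < length p" "j < length p" "v = p ! i" "u = p ! j"
      by (auto simp: in_set_conv_nth)
    with rtrancl_trans[OF down[of i] up[of j]] show ?thesis by simp
  qed
  show ?thesis
  proof
    show "component ?E v \<subseteq> path_edges p"
      unfolding component_def using edge stay by blast
    show "path_edges p \<subseteq> component ?E v"
    proof
      fix e assume e: "e \<in> path_edges p"
      then obtain u where "u \<in> e" "u \<in> set p" using path_edges_subset by blast
      with e p reach show "e \<in> component ?E v" unfolding component_def by blast
    qed
  qed
qed

lemma components_paths:
  assumes disj: "\<And>p q. p \<in> \<P> \<Longrightarrow> q \<in> \<P> \<Longrightarrow> set p \<inter> set q \<noteq> {} \<Longrightarrow> p = q"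
    and len: "\<And>p. p \<in> \<P> \<Longrightarrow> 2 \<le> length p"
  shows "components (\<Union> (path_edges ` \<P>)) = path_edges ` \<P>"
proof -
  have "\<Union>(\<Union> (path_edges ` \<P>)) = (\<Union>p\<in>\<P>. set p)"
    using len by (force simp: Union_path_edges[symmetric])
  moreover have "\<exists>v. v \<in> set p" if "p \<in> \<P>" for p using len[OF that] by (cases p) auto
  ultimately show ?thesis
    using component_path[of \<P>, OF disj] unfolding components_def by (fastforce simp: image_iff)
qed

section \<open>Lattice paths\<close>

definition ones :: "bitstring \<Rightarrow> nat" where
  "ones x = length (filter id x)"

lemma ones_simps [simp]:
  "ones [] = 0" "ones (b # x) = of_bool b + ones x" "ones (x @ y) = ones x + ones y"
  "ones (rev x) = ones x"
  by (auto simp: ones_def rev_filter[symmetric])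

lemma ones_le: "ones x \<le> length x"
  by (simp add: ones_def)

lemma ones_Not: "ones (map Not x) = length x - ones x"
  using ones_le by (induction x) (auto simp: Suc_diff_le)

lemma layer_iff: "x \<in> layer n k \<longleftrightarrow> length x = n \<and> ones x = k"
  by (auto simp: layer_def ones_def length_filter_conv_card)

lemma ones_take_mono: "i \<le> j \<Longrightarrow> ones (take i x) \<le> ones (take j x)"
  by (metis le_add1 min_absorb2 ones_simps(3) take_add le_add_diff_inverse)

text \<open>Only heights at odd positions enter, because \<open>map_f\<close> does not respect the others. They suffice:
  a negative height at an even position lies between two negative heights, unless it is the last.\<close>

definition flaws :: "bitstring \<Rightarrow> nat set" where
  "flaws x = {i. 2 * i < length x \<and> ones (take (2 * i + 1) x) \<le> i}"

text \<open>Returns to height 0, counted in pairs of steps since they occur only at even positions;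
  \<open>0 < i\<close> excludes the start.\<close>

definition touches :: "bitstring \<Rightarrow> nat set" where
  "touches x = {i. 0 < i \<and> 2 * i \<le> length x \<and> ones (take (2 * i) x) = i}"

text \<open>The only new odd position is the one after the first appended bit.\<close>

lemma flaws_append:
  assumes "length x = 2 * n"
  shows "flaws (x @ [a, b]) = flaws x \<union> (if ones x + of_bool a \<le> n then {n} else {})"
proof -
  have "i \<in> flaws (x @ [a, b]) \<longleftrightarrow> i \<in> flaws x \<union> (if ones x + of_bool a \<le> n then {n} else {})" for i
  proof (rule linorder_cases[of i n])
    assume "i < n" then show ?thesis using assms by (auto simp: flaws_def)
  next
    assume "i = n" then show ?thesis using assms by (auto simp: flaws_def)
  next
    assume "n < i" then show ?thesis using assms by (auto simp: flaws_def)
  qed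
  then show ?thesis by blast
qed

lemma touches_append:
  assumes "length x = 2 * n"
  shows "touches (x @ [a, b]) = touches x \<union> (if ones x + of_bool a + of_bool b = Suc n then {Suc n} else {})"
proof -
  have "i \<in> touches (x @ [a, b]) \<longleftrightarrow>
      i \<in> touches x \<union> (if ones x + of_bool a + of_bool b = Suc n then {Suc n} else {})" for i
  proof (rule linorder_cases[of i "Suc n"])
    assume "i < Suc n" then show ?thesis using assms by (auto simp: touches_def)
  next
    assume "i = Suc n" then show ?thesis using assms by (auto simp: touches_def)
  next
    assume "Suc n < i" then show ?thesis using assms by (auto simp: touches_def)
  qed
  then show ?thesis by blast
qed

lemma touches_end: "\<lbrakk>length x = 2 * n; ones x = n; 1 \<le> n\<rbrakk> \<Longrightarrow> n \<in> touches x"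
  by (auto simp: touches_def)

text \<open>A negative final height is even, hence at most -2, and the height one step earlier is
  still negative.\<close>

lemma flaws_nonempty:
  assumes "even (length x)" "2 * ones x < length x"
  shows "flaws x \<noteq> {}"
proof -
  from assms obtain n where n: "length x = 2 * n" "ones x < n" by (auto elim: evenE)
  have "ones (take (2 * (n - 1) + 1) x) \<le> ones (take (2 * n) x)"
    using n(2) by (intro ones_take_mono) linarith
  with n have "n - 1 \<in> flaws x" by (auto simp: flaws_def)
  then show ?thesis by blast
qed

lemma flaws_less: "\<lbrakk>length x = 2 * n; i \<in> flaws x\<rbrakk> \<Longrightarrow> i < n"
  by (auto simp: flaws_def)

text \<open>For words to which the next pair adds the flaw \<open>n\<close>: having exactly one flaw
  then means having had none before.\<close>

lemma flaws_subset_end: "length x = 2 * n \<Longrightarrow> flaws x \<subseteq> {n} \<longleftrightarrow> flaws x = {}"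
  using flaws_less by blast

section \<open>The map \<open>map_f\<close> and its effect on heights\<close>

lemma length_swap_pairs [simp]: "length (swap_pairs a x) = length x"
  by (induction a x rule: swap_pairs.induct) auto

lemma length_perm_pi [simp]: "length (perm_pi a x) = length x"
  by (cases x) auto

lemma length_map_f [simp]: "length (map_f a x) = length x"
  by (simp add: map_f_def)

lemma ones_take_swap_pairs: "ones (take (2 * i) (swap_pairs a x)) = ones (take (2 * i) x)"
proof (induction a x arbitrary: i rule: swap_pairs.induct)
  case (1 a as x y xs)
  then show ?case by (cases i) auto
qed auto

text \<open>The first bit is fixed and swaps stay inside the pairs after it, so a prefix of odd
  length keeps its bits up to order.\<close>

lemma ones_take_perm_pi: "ones (take (2 * i + 1) (perm_pi a x)) = ones (take (2 * i + 1) x)"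
  by (cases x) (auto simp: ones_take_swap_pairs)

lemma ones_swap_pairs: "ones (swap_pairs a x) = ones x"
  by (induction a x rule: swap_pairs.induct) auto

lemma ones_perm_pi [simp]: "ones (perm_pi a x) = ones x"
  by (cases x) (auto simp: ones_swap_pairs)

lemma ones_map_f: "ones (map_f a x) = length x - ones x"
  by (simp add: map_f_def ones_Not)

text \<open>The word ends at height 0, so reversal with complement carries the height at position
  \<open>2 * (n - 1 - i) + 1\<close> to position \<open>2 * i + 1\<close>.\<close>

lemma flaws_map_f:
  assumes "length x = 2 * n" "ones x = n"
  shows "flaws (map_f a x) = (\<lambda>j. n - 1 - j) ` flaws x"
proof -
  let ?y = "perm_pi a x"
  have key: "i \<in> flaws (map_f a x) \<longleftrightarrow> n - 1 - i \<in> flaws x" if "i < n" for i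
  proof -
    have eq: "2 * n - (2 * i + 1) = 2 * (n - 1 - i) + 1" using that by linarith
    have tk: "take (2 * i + 1) (rev ?y) = rev (drop (2 * (n - 1 - i) + 1) ?y)"
      using assms eq by (simp add: take_rev)
    \<comment> \<open>The ones of the suffix are \<open>n\<close> minus those of a prefix of odd
      length, where the permutation leaves no trace.\<close>
    have "n = ones (take (2 * (n - 1 - i) + 1) ?y @ drop (2 * (n - 1 - i) + 1) ?y)"
      using assms by (metis append_take_drop_id ones_perm_pi)
    then have sum: "n = ones (take (2 * (n - 1 - i) + 1) x) + ones (drop (2 * (n - 1 - i) + 1) ?y)"
      by (simp only: ones_simps(3) ones_take_perm_pi)
    have "ones (take (2 * i + 1) (map_f a x)) =
        length (drop (2 * (n - 1 - i) + 1) ?y) - ones (drop (2 * (n - 1 - i) + 1) ?y)"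
      by (simp only: map_f_def take_map tk ones_Not length_rev ones_simps)
    also have "length (drop (2 * (n - 1 - i) + 1) ?y) = 2 * i + 1" using assms that by simp
    finally have "ones (take (2 * i + 1) (map_f a x)) \<le> i \<longleftrightarrow> ones (take (2 * (n - 1 - i) + 1) x) \<le> n - 1 - i"
      using sum that by linarith
    then show ?thesis using assms that by (simp add: flaws_def)
  qed
  show ?thesis
  proof (intro equalityI subsetI)
    fix i assume i: "i \<in> flaws (map_f a x)"
    with assms have "i < n" using flaws_less[of "map_f a x" n i] by simp
    with i key[of i] show "i \<in> (\<lambda>j. n - 1 - j) ` flaws x"
      by (intro image_eqI[of _ _ "n - 1 - i"]) auto
  next
    fix i assume "i \<in> (\<lambda>j. n - 1 - j) ` flaws x"
    then obtain j where j: "j \<in> flaws x" "i = n - 1 - j" by blast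
    with assms flaws_less have "j < n" by blast
    with j key[of i] show "i \<in> flaws (map_f a x)" by simp
  qed
qed

lemma swap_pairs_invol: "swap_pairs a (swap_pairs a x) = x"
  by (induction a x rule: swap_pairs.induct) auto

lemma perm_pi_invol [simp]: "perm_pi a (perm_pi a x) = x"
  by (cases x) (auto simp: swap_pairs_invol)

lemma inj_map_f: "inj (map_f a)"
proof (rule injI)
  fix x y assume "map_f a x = map_f a y"
  then have "perm_pi a x = perm_pi a y"
    by (auto simp: map_f_def inj_map_eq_map inj_def)
  then show "x = y" by (metis perm_pi_invol)
qed

lemma map_f_surj: "map_f a (perm_pi a (rev (map Not y))) = y"
  by (simp add: map_f_def rev_map comp_def)

section \<open>Hamming distance\<close>

definition hamming :: "bitstring \<Rightarrow> bitstring \<Rightarrow> nat" where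
  "hamming x y = length (filter (\<lambda>(a, b). a \<noteq> b) (zip x y))"

lemma hamming_simps [simp]:
  "hamming [] [] = 0" "hamming (a # x) (b # y) = of_bool (a \<noteq> b) + hamming x y"
  by (auto simp: hamming_def)

lemma hamming_append:
  "length x = length y \<Longrightarrow> hamming (x @ z) (y @ z') = hamming x y + hamming z z'"
  by (simp add: hamming_def)

lemma hamming_refl [simp]: "hamming z z = 0"
  by (induction z) auto

lemma hamming_commute: "hamming x y = hamming y x"
proof -
  have "hamming x y = length (filter (\<lambda>(a, b). a \<noteq> b) (map (\<lambda>(a, b). (b, a)) (zip y x)))"
    by (simp add: hamming_def zip_commute[of x y])
  also have "\<dots> = hamming y x"
    by (auto simp: hamming_def filter_map comp_def split_def intro!: arg_cong[where f = length] filter_cong)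
  finally show ?thesis .
qed

text \<open>Connects the list form, which suits induction, with the cardinality in
  \<open>cube_edges\<close>.\<close>

lemma hamming_card:
  "length x = n \<Longrightarrow> length y = n \<Longrightarrow> hamming x y = card {i. i < n \<and> x ! i \<noteq> y ! i}"
  by (auto simp: hamming_def length_filter_conv_card intro!: arg_cong[where f = card])

lemma hamming_swap_pairs:
  "length x = length y \<Longrightarrow> hamming (swap_pairs a x) (swap_pairs a y) = hamming x y"
proof (induction a x arbitrary: y rule: swap_pairs.induct)
  case (1 a as u v xs)
  then obtain u' v' ys where "y = u' # v' # ys" by (metis length_Suc_conv)
  with 1 show ?case by auto
next
  case ("2_3" as v)
  then show ?case by (cases y) auto
qed (auto simp: length_Suc_conv)

lemma hamming_map_f:
  assumes "length x = length y"
  shows "hamming (map_f a x) (map_f a y) = hamming x y"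
proof -
  have "hamming (perm_pi a x) (perm_pi a y) = hamming x y"
    using assms by (cases x; cases y) (auto simp: hamming_swap_pairs)
  moreover have "hamming (rev u) (rev v) = hamming u v" if "length u = length v" for u v
    using that by (simp add: hamming_def zip_rev rev_filter[symmetric])
  moreover have "hamming (map Not u) (map Not v) = hamming u v" for u v
    by (auto simp: hamming_def zip_map_map filter_map comp_def split_def intro!: arg_cong[where f = length] filter_cong)
  ultimately show ?thesis using assms by (simp add: map_f_def)
qed

section \<open>Classes of lattice paths and their recursions\<close>

definition nonneg_touching :: "nat \<Rightarrow> nat \<Rightarrow> bitstring set" where
  "nonneg_touching n k = {x \<in> layer (2 * n) k. flaws x = {} \<and> touches x \<noteq> {}}"

definition positive :: "nat \<Rightarrow> nat \<Rightarrow> bitstring set" where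
  "positive n k = {x \<in> layer (2 * n) k. flaws x = {} \<and> touches x = {}}"

definition one_flaw :: "nat \<Rightarrow> nat \<Rightarrow> bitstring set" where
  "one_flaw n k = {x \<in> layer (2 * n) k. \<exists>j. flaws x = {j}}"

text \<open>The vertices on the paths at level \<open>k\<close>. For \<open>k = n\<close> and
  \<open>1 \<le> n\<close> these are both full layers, since a word ending at height 0 is not
  positive.\<close>

definition covered :: "nat \<Rightarrow> nat \<Rightarrow> bitstring set" where
  "covered n k = (layer (2 * n) k - positive n k) \<union> layer (2 * n) (k + 1)"

lemma finite_layer: "finite (layer n k)"
  by (rule finite_subset[OF _ finite_lists_length_eq[of "UNIV :: bool set" n]]) (auto simp: layer_iff)

text \<open>Each recursion appends two bits, so equality of two classes reduces to the four possible
  endings.\<close>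

lemma eq_by_last_two:
  assumes "\<And>z. z \<in> A \<Longrightarrow> length z = 2 * Suc n" "\<And>z. z \<in> B \<Longrightarrow> length z = 2 * Suc n"
    and "\<And>x a b. length x = 2 * n \<Longrightarrow> x @ [a, b] \<in> A \<longleftrightarrow> x @ [a, b] \<in> B"
  shows "A = B"
proof -
  have "z \<in> A \<longleftrightarrow> z \<in> B" if "length z = 2 * Suc n" for z :: "'a list"
  proof -
    from that obtain y b where y: "z = y @ [b]" by (cases z rule: rev_cases) auto
    with that obtain x a where "y = x @ [a]" by (cases y rule: rev_cases) auto
    with y that assms(3)[of x a b] show ?thesis by simp
  qed
  with assms(1,2) show ?thesis by blast
qed

lemmas word_set_defs = nonneg_touching_def positive_def one_flaw_def covered_def layer_iff

context
  fixes n :: nat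
  assumes n_pos: "1 \<le> n"
begin

text \<open>Before the last pair the height is 2 for the ending \<open>[False, False]\<close> and 0
  for \<open>[True, False]\<close>. The endings \<open>[False, True]\<close> and
  \<open>[True, True]\<close> start at heights 0 and -2 and produce the flaw
  \<open>n\<close>.\<close>

lemma nonneg_touching_middle:
  "nonneg_touching (Suc n) (Suc n) =
    (\<lambda>x. x @ [False, False]) ` nonneg_touching n (n + 1) \<union>
    (\<lambda>x. x @ [False, False]) ` positive n (n + 1) \<union>
    (\<lambda>x. x @ [True, False]) ` nonneg_touching n n"
  by (rule eq_by_last_two[where n = n])
    (use n_pos touches_end[of _ n] in
      \<open>auto simp: word_set_defs image_iff flaws_append touches_append split: if_splits\<close>)

text \<open>The ending \<open>[True, True]\<close> is missing because the height before it would be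
  0, a return.\<close>

lemma positive_middle:
  "positive (Suc n) (Suc n + 1) =
    (\<lambda>x. x @ [False, False]) ` positive n (n + 2) \<union>
    (\<lambda>x. x @ [True, False]) ` positive n (n + 1) \<union>
    (\<lambda>x. x @ [False, True]) ` positive n (n + 1)"
  by (rule eq_by_last_two[where n = n])
    (use n_pos touches_end[of _ n] in
      \<open>auto simp: word_set_defs image_iff flaws_append touches_append split: if_splits\<close>)

text \<open>The ending \<open>[False, True]\<close> adds the flaw \<open>n\<close> to a flawless
  word. The ending \<open>[True, True]\<close> also adds it, but follows height -2, where
  \<open>flaws_nonempty\<close> yields an earlier flaw.\<close>

lemma one_flaw_middle:
  "one_flaw (Suc n) (Suc n) =
    (\<lambda>x. x @ [False, False]) ` one_flaw n (n + 1) \<union>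
    (\<lambda>x. x @ [True, False]) ` one_flaw n n \<union>
    (\<lambda>x. x @ [False, True]) ` nonneg_touching n n"
  by (rule eq_by_last_two[where n = n])
    (use n_pos touches_end[of _ n] in
      \<open>auto simp: word_set_defs image_iff flaws_append flaws_subset_end flaws_nonempty split: if_splits\<close>)

text \<open>The positive words followed by \<open>[False, False]\<close> are missed by the old paths
  and become the starts of the new ones. The words ending in \<open>True\<close> come from the
  vertices of the 2-factor.\<close>

lemma covered_middle:
  "covered (Suc n) (Suc n) =
    (\<lambda>x. x @ [False, False]) ` covered n (n + 1) \<union>
    (\<lambda>x. x @ [True, False]) ` covered n n \<union>
    (\<lambda>x. x @ [False, False]) ` positive n (n + 1) \<union>
    (\<lambda>x. x @ [True]) ` cube_vertices (2 * n + 1) n"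
  by (rule eq_by_last_two[where n = n])
    (use n_pos touches_end[of _ n] in
      \<open>auto simp: word_set_defs cube_vertices_def image_iff flaws_append touches_append split: if_splits\<close>)

text \<open>For \<open>n + 2 \<le> k\<close> the last pair adds neither a flaw nor a touch: the
  height is at least 1 after its first bit and at least 2 at its end.\<close>

lemma 
  assumes "n + 2 \<le> k"
  shows nonneg_touching_upper:
    "nonneg_touching (Suc n) k =
      (\<lambda>x. x @ [False, False]) ` nonneg_touching n k \<union>
      (\<lambda>x. x @ [True, False]) ` nonneg_touching n (k - 1) \<union>
      (\<lambda>x. x @ [False, True]) ` nonneg_touching n (k - 1) \<union>
      (\<lambda>x. x @ [True, True]) ` nonneg_touching n (k - 2)"
  and positive_upper:
    "positive (Suc n) k =
      (\<lambda>x. x @ [False, False]) ` positive n k \<union>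
      (\<lambda>x. x @ [True, False]) ` positive n (k - 1) \<union>
      (\<lambda>x. x @ [False, True]) ` positive n (k - 1) \<union>
      (\<lambda>x. x @ [True, True]) ` positive n (k - 2)"
  and one_flaw_upper:
    "one_flaw (Suc n) k =
      (\<lambda>x. x @ [False, False]) ` one_flaw n k \<union>
      (\<lambda>x. x @ [True, False]) ` one_flaw n (k - 1) \<union>
      (\<lambda>x. x @ [False, True]) ` one_flaw n (k - 1) \<union>
      (\<lambda>x. x @ [True, True]) ` one_flaw n (k - 2)"
  and covered_upper:
    "covered (Suc n) k =
      (\<lambda>x. x @ [False, False]) ` covered n k \<union>
      (\<lambda>x. x @ [True, False]) ` covered n (k - 1) \<union>
      (\<lambda>x. x @ [False, True]) ` covered n (k - 1) \<union>
      (\<lambda>x. x @ [True, True]) ` covered n (k - 2)"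
  by (rule eq_by_last_two[where n = n];
      use assms in \<open>auto simp: word_set_defs image_iff flaws_append touches_append split: if_splits\<close>)+

end

section \<open>Families of paths between two layers\<close>

text \<open>The induction invariant. A path with \<open>4 * j + 3\<close> vertices has
  \<open>4 * j + 2\<close> edges, so the flaw of the last vertex encodes the length.\<close>

locale path_family =
  fixes n k :: nat and \<P> :: "bitstring list set"
  assumes distinct_path: "p \<in> \<P> \<Longrightarrow> distinct p"
    and steps: "p \<in> \<P> \<Longrightarrow> successively (\<lambda>x y. hamming x y = 1) p"
    and length_path: "p \<in> \<P> \<Longrightarrow> \<exists>j. flaws (last p) = {j} \<and> length p = 4 * j + 3"
    and disjoint_paths: "\<lbrakk>p \<in> \<P>; q \<in> \<P>; x \<in> set p; x \<in> set q\<rbrakk> \<Longrightarrow> p = q"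
    and cover: "\<Union>(set ` \<P>) = covered n k"
    and firsts_eq: "firsts \<P> = nonneg_touching n k"
    and seconds_eq: "seconds \<P> = positive n (k + 1)"
    and lasts_eq: "lasts \<P> = one_flaw n k"
begin

lemma length_ge: "p \<in> \<P> \<Longrightarrow> 3 \<le> length p"
  using length_path by fastforce

lemma nonempty: "p \<in> \<P> \<Longrightarrow> p \<noteq> []"
  using length_ge by fastforce

lemma hd_inj: "\<lbrakk>p \<in> \<P>; q \<in> \<P>; hd p = hd q\<rbrakk> \<Longrightarrow> p = q"
  by (metis disjoint_paths hd_in_set nonempty)

lemma last_inj: "\<lbrakk>p \<in> \<P>; q \<in> \<P>; last p = last q\<rbrakk> \<Longrightarrow> p = q"
  by (metis disjoint_paths last_in_set nonempty)

lemma finite_family: "finite \<P>"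
proof (rule finite_imageD)
  show "finite (hd ` \<P>)"
    using firsts_eq finite_subset[OF _ finite_layer[of "2 * n" k]]
    by (auto simp: firsts_def nonneg_touching_def)
  show "inj_on hd \<P>" using hd_inj by (auto intro: inj_onI)
qed

lemma vertex_layer: "\<lbrakk>p \<in> \<P>; x \<in> set p\<rbrakk> \<Longrightarrow> x \<in> layer (2 * n) k \<union> layer (2 * n) (k + 1)"
  using cover by (auto simp: covered_def)

end

lemma append_paths_eq: "append_paths \<P> y = map (\<lambda>x. x @ y) ` \<P>"
  by (simp add: append_paths_def append_vertex_def[abs_def])

lemma successively_append_word:
  assumes "successively (\<lambda>x y. hamming x y = 1) p" "\<And>x. x \<in> set p \<Longrightarrow> length x = m"
  shows "successively (\<lambda>x y. hamming x y = 1) (map (\<lambda>x. x @ z) p)"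
  unfolding successively_map using assms(1)
  by (rule successively_mono) (auto simp: hamming_append assms(2))

context path_family
begin

lemma vertex_length: "\<lbrakk>p \<in> \<P>; x \<in> set p\<rbrakk> \<Longrightarrow> length x = 2 * n"
  using vertex_layer by (auto simp: layer_iff)

lemma firsts_append: "firsts (append_paths \<P> y) = (\<lambda>x. x @ y) ` nonneg_touching n k"
  unfolding firsts_eq[symmetric] by (force simp: firsts_def append_paths_eq image_image hd_map nonempty)

lemma lasts_append: "lasts (append_paths \<P> y) = (\<lambda>x. x @ y) ` one_flaw n k"
  unfolding lasts_eq[symmetric] by (force simp: lasts_def append_paths_eq image_image last_map nonempty)

lemma seconds_append: "seconds (append_paths \<P> y) = (\<lambda>x. x @ y) ` positive n (k + 1)"
proof -
  have "map (\<lambda>x. x @ y) p ! 1 = p ! 1 @ y" if "p \<in> \<P>" for p using length_ge[OF that] by simp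
  then show ?thesis
    unfolding seconds_eq[symmetric] by (force simp: seconds_def append_paths_eq image_image)
qed

lemma cover_append: "\<Union>(set ` append_paths \<P> y) = (\<lambda>x. x @ y) ` covered n k"
  unfolding cover[symmetric] by (force simp: append_paths_eq)

text \<open>The last vertex has \<open>k\<close> ones; \<open>n < k + of_bool a\<close> says that it
  is still above height 0 after the bit \<open>a\<close>, so no flaw is added.\<close>

lemma append_paths_family:
  assumes "p \<in> append_paths \<P> [a, b]"
  shows "distinct p" "successively (\<lambda>x y. hamming x y = 1) p"
    and "n < k + of_bool a \<Longrightarrow> \<exists>j. flaws (last p) = {j} \<and> length p = 4 * j + 3"
proof -
  from assms obtain q where q: "q \<in> \<P>" "p = map (\<lambda>x. x @ [a, b]) q" by (auto simp: append_paths_eq)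
  show "distinct p" using q distinct_path by (auto simp: distinct_map inj_on_def)
  show "successively (\<lambda>x y. hamming x y = 1) p"
    using q steps vertex_length successively_append_word by blast
  have "last q \<in> one_flaw n k" using lasts_eq q by (auto simp: lasts_def)
  moreover assume "n < k + of_bool a"
  ultimately have "flaws (last q @ [a, b]) = flaws (last q)"
    by (auto simp: one_flaw_def layer_iff flaws_append)
  then show "\<exists>j. flaws (last p) = {j} \<and> length p = 4 * j + 3"
    using length_path[OF q(1)] q nonempty by (simp add: last_map)
qed

lemma append_paths_disjoint:
  "\<lbrakk>p \<in> append_paths \<P> y; q \<in> append_paths \<P> y; x \<in> set p; x \<in> set q\<rbrakk> \<Longrightarrow> p = q"
  using disjoint_paths by (fastforce simp: append_paths_eq)

end

lemma append_paths_vertex: "\<lbrakk>p \<in> append_paths \<P> y; x \<in> set p\<rbrakk> \<Longrightarrow> \<exists>u. x = u @ y"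
  by (auto simp: append_paths_eq)

section \<open>The middle layers\<close>

locale middle_family = path_family n n \<P> for n \<P> +
  fixes a :: "bool list"
  assumes n_pos: "1 \<le> n"
begin

text \<open>\<open>flaws_map_f\<close> keeps the word flawless, and the image again ends at height
  0, which supplies the touch.\<close>

lemma map_f_firsts: "x \<in> firsts \<P> \<Longrightarrow> map_f a x \<in> firsts \<P>"
  unfolding firsts_eq nonneg_touching_def
  using n_pos touches_end[of "map_f a x" n]
  by (auto simp: layer_iff ones_map_f flaws_map_f)

lemma map_f_lasts: "x \<in> lasts \<P> \<Longrightarrow> map_f a x \<in> lasts \<P>"
  unfolding lasts_eq one_flaw_def by (auto simp: layer_iff ones_map_f flaws_map_f)

lemma map_f_firsts_surj: "map_f a ` firsts \<P> = firsts \<P>"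
  using map_f_firsts finite_family inj_on_subset[OF inj_map_f]
  by (intro endo_inj_surj) (auto simp: firsts_def)

lemma map_f_lasts_surj: "map_f a ` lasts \<P> = lasts \<P>"
  using map_f_lasts finite_family inj_on_subset[OF inj_map_f]
  by (intro endo_inj_surj) (auto simp: lasts_def)

text \<open>The cycle through \<open>p\<close> continues with the image of \<open>partner p\<close>, traversed backwards.\<close>

definition partner :: "bitstring list \<Rightarrow> bitstring list" where
  "partner p = (SOME q. q \<in> \<P> \<and> map_f a (last q) = last p)"

text \<open>Traversed backwards, the image of \<open>partner p\<close> ends at a first vertex by
  \<open>map_f_firsts\<close>; the cycle goes on with the path that starts there.\<close>

definition next_path :: "bitstring list \<Rightarrow> bitstring list" where
  "next_path p = (SOME q. q \<in> \<P> \<and> hd q = map_f a (hd (partner p)))"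

lemma partner:
  assumes "p \<in> \<P>"
  shows "partner p \<in> \<P>" "map_f a (last (partner p)) = last p"
proof -
  have "last p \<in> map_f a ` last ` \<P>" using assms map_f_lasts_surj by (auto simp: lasts_def)
  then have "\<exists>q. q \<in> \<P> \<and> map_f a (last q) = last p" by force
  from someI_ex[OF this] show "partner p \<in> \<P>" "map_f a (last (partner p)) = last p"
    by (auto simp: partner_def)
qed

lemma partner_inj: "\<lbrakk>p \<in> \<P>; q \<in> \<P>; partner p = partner q\<rbrakk> \<Longrightarrow> p = q"
  using partner(2)[of p] partner(2)[of q] last_inj by simp

lemma partner_surj: "partner ` \<P> = \<P>"
  using partner(1) partner_inj finite_family by (intro endo_inj_surj) (auto intro: inj_onI)

lemma next_path:
  assumes "p \<in> \<P>"
  shows "next_path p \<in> \<P>" "hd (next_path p) = map_f a (hd (partner p))"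
proof -
  have "map_f a (hd (partner p)) \<in> hd ` \<P>"
    using map_f_firsts partner(1)[OF assms] by (auto simp: firsts_def)
  then have "\<exists>q. q \<in> \<P> \<and> hd q = map_f a (hd (partner p))" by force
  from someI_ex[OF this] show "next_path p \<in> \<P>" "hd (next_path p) = map_f a (hd (partner p))"
    by (auto simp: next_path_def)
qed

lemma next_path_surj: "next_path ` \<P> = \<P>"
proof (rule endo_inj_surj[OF finite_family])
  show "inj_on next_path \<P>"
  proof (rule inj_onI)
    fix p q assume *: "p \<in> \<P>" "q \<in> \<P>" "next_path p = next_path q"
    then have "map_f a (hd (partner p)) = map_f a (hd (partner q))" by (metis next_path(2))
    then have "hd (partner p) = hd (partner q)" using inj_map_f by (simp add: inj_eq)
    then show "p = q" using * hd_inj partner(1) partner_inj by blast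
  qed
qed (use next_path(1) in blast)

definition body :: "bitstring list \<Rightarrow> bitstring list" where
  "body p = map (\<lambda>x. x @ [False]) p @ map (\<lambda>x. map_f a x @ [True]) (rev (partner p))"

text \<open>\<open>body p\<close> lists the vertices of one string; the added vertex is the start of
  the next string, so the linking edge is included.\<close>

definition walk :: "bitstring list \<Rightarrow> bitstring list" where
  "walk p = body p @ [map_f a (hd (partner p)) @ [False]]"

text \<open>If \<open>partner p\<close> has flaw index \<open>i\<close>, then \<open>p\<close> has
  \<open>n - 1 - i\<close>, and \<open>(4 * (n - 1 - i) + 3) + (4 * i + 3) = 4 * n + 2\<close> for
  every \<open>i < n\<close>.\<close>

lemma length_body: "p \<in> \<P> \<Longrightarrow> length (body p) = 4 * n + 2"
proof -
  assume p: "p \<in> \<P>"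
  obtain j where j: "flaws (last p) = {j}" "length p = 4 * j + 3"
    using length_path[OF p] by blast
  obtain i where i: "flaws (last (partner p)) = {i}" "length (partner p) = 4 * i + 3"
    using length_path partner(1)[OF p] by blast
  have "last (partner p) \<in> layer (2 * n) n"
    using lasts_eq partner(1)[OF p] by (auto simp: lasts_def one_flaw_def)
  then have "length (last (partner p)) = 2 * n" "ones (last (partner p)) = n"
    by (auto simp: layer_iff)
  then have "{j} = {n - 1 - i}" "i < n"
    using flaws_map_f[of "last (partner p)" n a] partner(2)[OF p] i j
      flaws_less[of "last (partner p)" n i] by auto
  then show ?thesis using i j by (simp add: body_def)
qed

lemma set_body: "set (body p) = (\<lambda>x. x @ [False]) ` set p \<union> (\<lambda>x. map_f a x @ [True]) ` set (partner p)"
  by (simp add: body_def image_image)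

lemma distinct_body: "p \<in> \<P> \<Longrightarrow> distinct (body p)"
proof -
  assume p: "p \<in> \<P>"
  have "inj_on (\<lambda>x. x @ [False]) X" "inj_on (\<lambda>x. map_f a x @ [True]) X" for X
    using injD[OF inj_map_f] by (auto intro!: inj_onI)
  then show ?thesis using distinct_path[OF p] distinct_path[OF partner(1)[OF p]]
    by (auto simp: body_def distinct_map)
qed

lemma disjoint_bodies:
  assumes "p \<in> \<P>" "q \<in> \<P>" "x \<in> set (body p)" "x \<in> set (body q)"
  shows "p = q"
proof -
  consider y where "y \<in> set p" "y \<in> set q" | y where "y \<in> set (partner p)" "y \<in> set (partner q)"
    using assms(3,4) by (auto simp: set_body inj_eq[OF inj_map_f])
  then show ?thesis
  proof cases
    case 1
    with assms disjoint_paths show ?thesis by blast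
  next
    case 2
    with assms disjoint_paths partner(1) have "partner p = partner q" by blast
    with assms partner_inj show ?thesis by blast
  qed
qed

sublocale necklace \<P> "\<lambda>p i. walk p ! i" next_path "4 * n + 2"
proof
  show "p = q \<and> i = j" if "p \<in> \<P>" "q \<in> \<P>" "i < 4 * n + 2" "j < 4 * n + 2" "walk p ! i = walk q ! j" for p q i j
  proof -
    have eq: "body p ! i = body q ! j" using that length_body by (simp add: walk_def nth_append)
    moreover from this that length_body have "p = q"
      by (intro disjoint_bodies[of p q "body p ! i"]) (auto simp: in_set_conv_nth)
    ultimately show ?thesis using that length_body distinct_body by (simp add: nth_eq_iff_index_eq)
  qed
  show "walk p ! (4 * n + 2) = walk (next_path p) ! 0" if "p \<in> \<P>" for p
    using that length_body[of p] next_path[of p] nonempty[of "next_path p"]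
    by (simp add: walk_def nth_append body_def hd_conv_nth)
qed (use finite_family next_path_surj n_pos in auto)

lemma walk_0: "p \<in> \<P> \<Longrightarrow> walk p ! 0 = hd p @ [False]"
  using nonempty[of p] by (simp add: walk_def body_def nth_append hd_conv_nth)

lemma walk_1: "p \<in> \<P> \<Longrightarrow> walk p ! Suc 0 = p ! 1 @ [False]"
  using length_ge[of p] by (simp add: walk_def body_def nth_append)

section \<open>Vertices and edges of the 2-factor\<close>

lemma beads_eq: "beads = cube_vertices (2 * n + 1) n"
proof -
  \<comment> \<open>A word ending at height 0 returns there, so at level \<open>n\<close> the paths
    visit both layers completely.\<close>
  have sub: "positive n n = {}"
    using touches_end[of _ n] n_pos by (auto simp: positive_def layer_iff)
  have "beads = (\<Union>p\<in>\<P>. set (body p))"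
  proof -
    have "set (body p) = {walk p ! j | j. j < 4 * n + 2}" if "p \<in> \<P>" for p
      unfolding set_conv_nth length_body[OF that]
      by (rule Collect_cong, rule iff_exI) (auto simp: length_body[OF that] walk_def nth_append)
    then show ?thesis unfolding beads_def by blast
  qed
  also have "\<dots> = (\<lambda>x. x @ [False]) ` \<Union>(set ` \<P>) \<union> (\<lambda>x. map_f a x @ [True]) ` \<Union>(set ` partner ` \<P>)"
    by (auto simp: set_body)
  also have "\<dots> = (\<lambda>x. x @ [False]) ` covered n n \<union> (\<lambda>x. map_f a x @ [True]) ` covered n n"
    by (simp add: partner_surj cover)
  also have "\<dots> = cube_vertices (2 * n + 1) n"
  proof (intro equalityI subsetI)
    fix z assume "z \<in> (\<lambda>x. x @ [False]) ` covered n n \<union> (\<lambda>x. map_f a x @ [True]) ` covered n n"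
    then show "z \<in> cube_vertices (2 * n + 1) n"
      using n_pos by (auto simp: covered_def cube_vertices_def layer_iff ones_map_f)
  next
    fix z assume z: "z \<in> cube_vertices (2 * n + 1) n"
    then obtain x b where zx: "z = x @ [b]" "length x = 2 * n"
      by (cases z rule: rev_cases) (auto simp: cube_vertices_def layer_iff)
    show "z \<in> (\<lambda>x. x @ [False]) ` covered n n \<union> (\<lambda>x. map_f a x @ [True]) ` covered n n"
    proof (cases b)
      case True
      \<comment> \<open>The preimage of \<open>x\<close> under \<open>map_f a\<close>; it has
        \<open>n\<close> or \<open>n + 1\<close> ones because \<open>x\<close> has \<open>n\<close>
        or \<open>n - 1\<close>.\<close>
      define y where "y = perm_pi a (rev (map Not x))"
      have "map_f a y = x" by (simp add: y_def map_f_surj)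
      moreover have "y \<in> covered n n"
        using z zx True n_pos ones_le[of x]
        by (auto simp: y_def covered_def sub cube_vertices_def layer_iff ones_Not)
      ultimately show ?thesis using zx True by blast
    next
      case False
      then show ?thesis using z zx by (auto simp: covered_def sub cube_vertices_def layer_iff)
    qed
  qed
  finally show ?thesis .
qed

lemma length_walk: "p \<in> \<P> \<Longrightarrow> length (walk p) = 4 * n + 3"
  using length_body by (simp add: walk_def)

lemma edges_walk: "edges = (\<Union>p\<in>\<P>. path_edges (walk p))"
proof -
  have "path_edges (walk p) = {{walk p ! j, walk p ! Suc j} | j. j < 4 * n + 2}" if "p \<in> \<P>" for p
    using length_walk[OF that] by (auto simp: path_edges_def)
  then show ?thesis unfolding edges_def by blast
qed

text \<open>The two explicit edges flip the final bit: one at \<open>last p\<close>, which is also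
  the image of \<open>last (partner p)\<close>, and one at the first vertex where the walk
  ends.\<close>

lemma path_edges_walk:
  assumes "p \<in> \<P>"
  shows "path_edges (walk p) = (`) (\<lambda>x. x @ [False]) ` path_edges p \<union>
    (`) (\<lambda>x. map_f a x @ [True]) ` path_edges (partner p) \<union>
    {{last p @ [False], last p @ [True]},
     {map_f a (hd (partner p)) @ [False], map_f a (hd (partner p)) @ [True]}}"
  using assms nonempty[of p] nonempty[of "partner p"] partner[of p]
  by (auto simp: walk_def body_def path_edges_append path_edges_rev path_edges_map
      last_map hd_map last_rev hd_rev insert_commute)

text \<open>\<open>partner\<close> permutes the family, so the walks use every path and every image
  once, and the flips exhaust the first and last vertices.\<close>

lemma build_factor_eq: "build_factor a \<P> = edges"
proof -
  have f: "(\<Union>p\<in>\<P>. g (partner p)) = (\<Union>p\<in>\<P>. g p)" for g :: "bitstring list \<Rightarrow> bitstring set set"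
    using partner_surj by (metis image_image)
  have hd: "(\<lambda>p. map_f a (hd (partner p))) ` \<P> = firsts \<P>"
    using partner_surj map_f_firsts_surj unfolding firsts_def by (metis image_image)
  have "{{v @ [False], v @ [True]} | v. v \<in> firsts \<P> \<union> lasts \<P>} =
      (\<Union>p\<in>\<P>. {{last p @ [False], last p @ [True]},
        {map_f a (hd (partner p)) @ [False], map_f a (hd (partner p)) @ [True]}})"
    unfolding hd[symmetric] lasts_def by auto
  moreover have "\<Union> (path_edges ` append_paths \<P> [False]) = (\<Union>p\<in>\<P>. (`) (\<lambda>x. x @ [False]) ` path_edges p)"
    by (simp add: append_paths_def path_edges_map append_vertex_def[abs_def])
  moreover have "\<Union> (path_edges ` append_paths (map (map_f a) ` \<P>) [True]) =
      (\<Union>p\<in>\<P>. (`) (\<lambda>x. map_f a x @ [True]) ` path_edges (partner p))"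
    unfolding f[of "\<lambda>q. (`) (\<lambda>x. map_f a x @ [True]) ` path_edges q"]
    by (simp add: append_paths_def path_edges_map append_vertex_def[abs_def] image_image comp_def)
  ultimately show ?thesis
    unfolding build_factor_def edges_walk
    by (simp only: SUP_cong[OF refl path_edges_walk] UN_Un_distrib)
qed

lemma walk_steps: "p \<in> \<P> \<Longrightarrow> successively (\<lambda>x y. hamming x y = 1) (walk p)"
proof -
  assume p: "p \<in> \<P>"
  note q = partner[OF p]
  have len: "length x = 2 * n" if "x \<in> set r" "r \<in> \<P>" for x r
    using vertex_layer[OF that(2,1)] by (auto simp: layer_iff)
  have "successively (\<lambda>x y. hamming x y = 1) (map (\<lambda>x. x @ [False]) p)"
    unfolding successively_map using steps[OF p]
    by (rule successively_mono) (use len p in \<open>auto simp: hamming_append\<close>)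
  moreover have "successively (\<lambda>x y. hamming x y = 1) (map (\<lambda>x. map_f a x @ [True]) (rev (partner p)))"
    unfolding successively_map successively_rev using steps[OF q(1)]
    by (rule successively_mono)
      (use len q in \<open>auto simp: hamming_append hamming_map_f hamming_commute\<close>)
  ultimately show ?thesis
    using nonempty[OF p] nonempty[OF q(1)] q
    by (auto simp: walk_def body_def successively_append_iff last_map hd_map last_rev hd_rev hamming_append)
qed

lemma edges_subset: "edges \<subseteq> cube_edges (2 * n + 1) n"
proof
  fix e assume e: "e \<in> edges"
  then obtain p where p: "p \<in> \<P>" "e \<in> path_edges (walk p)" using edges_walk by blast
  from walk_steps[OF p(1)] p(2) obtain x y where xy: "hamming x y = 1" "e = {x, y}"
    by (rule successively_path_edges)
  with e have "x \<in> cube_vertices (2 * n + 1) n" "y \<in> cube_vertices (2 * n + 1) n"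
    using edge_cases beads_eq by blast+
  moreover from this have "length x = 2 * n + 1" "length y = 2 * n + 1"
    by (auto simp: cube_vertices_def layer_iff)
  then have "card {i. i < 2 * n + 1 \<and> x ! i \<noteq> y ! i} = 1"
    using hamming_card xy(1) by metis
  ultimately show "e \<in> cube_edges (2 * n + 1) n"
    using xy(2) unfolding cube_edges_def by blast
qed

section \<open>The paths added in the induction step\<close>

definition new_path :: "bitstring list \<Rightarrow> bitstring list" where
  "new_path p = (p ! 1 @ [False, False]) # map (\<lambda>x. x @ [True]) (tl (walk p))"

text \<open>Deleting the first edge of each string leaves pieces from the second vertex of
  \<open>p\<close> to the first vertex of \<open>next_path p\<close>. Starting at the second vertex
  is what lets \<open>new_path\<close> begin with an edge that flips the last bit.\<close>

lemma tl_walk: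
  assumes "p \<in> \<P>"
  obtains r where "tl (walk p) = (p ! 1 @ [False]) # r"
proof -
  have "tl (walk p) \<noteq> []" "hd (tl (walk p)) = p ! 1 @ [False]"
    using length_walk[OF assms] walk_1[OF assms]
    by (cases "walk p"; force simp: hd_conv_nth neq_Nil_conv length_Suc_conv)+
  then show thesis using that by (metis list.collapse)
qed

lemma length_new_path: "p \<in> \<P> \<Longrightarrow> length (new_path p) = 4 * n + 3"
  using length_walk by (simp add: new_path_def)

lemma new_path_hd [simp]: "hd (new_path p) = p ! 1 @ [False, False]" "new_path p ! 0 = p ! 1 @ [False, False]"
  by (simp_all add: new_path_def)

lemma new_path_1: "p \<in> \<P> \<Longrightarrow> new_path p ! 1 = p ! 1 @ [False, True]"
  by (rule tl_walk[of p]) (auto simp: new_path_def)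

lemma last_new_path: "p \<in> \<P> \<Longrightarrow> last (new_path p) = map_f a (hd (partner p)) @ [False, True]"
  using length_body[of p] by (cases "body p") (simp_all add: new_path_def walk_def)

lemma second_inj: "\<lbrakk>p \<in> \<P>; q \<in> \<P>; p ! 1 = q ! 1\<rbrakk> \<Longrightarrow> p = q"
proof -
  assume pq: "p \<in> \<P>" "q \<in> \<P>" "p ! 1 = q ! 1"
  then have "p ! 1 \<in> set p" "q ! 1 \<in> set q"
    using length_ge[of p] length_ge[of q] nth_mem[of 1 p] nth_mem[of 1 q] by linarith+
  with pq disjoint_paths show ?thesis by metis
qed

lemma tl_walk_nth: "\<lbrakk>p \<in> \<P>; i < 4 * n + 2\<rbrakk> \<Longrightarrow> tl (walk p) ! i = walk p ! Suc i"
  using length_walk[of p] by (simp add: nth_tl)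

lemma distinct_tl_walk:
  assumes "p \<in> \<P>"
  shows "distinct (tl (walk p))"
proof -
  have "i = j" if "i < 4 * n + 2" "j < 4 * n + 2" "tl (walk p) ! i = tl (walk p) ! j" for i j
    using tails_inj[OF assms assms that(1,2)] that(3) tl_walk_nth[OF assms] that(1,2) by simp
  then show ?thesis using length_walk[OF assms] unfolding distinct_conv_nth by fastforce
qed

lemma disjoint_tl_walk:
  assumes "p \<in> \<P>" "q \<in> \<P>" "x \<in> set (tl (walk p))" "x \<in> set (tl (walk q))"
  shows "p = q"
proof -
  from assms obtain i j where "i < 4 * n + 2" "x = tl (walk p) ! i" "j < 4 * n + 2" "x = tl (walk q) ! j"
    using length_walk by (auto simp: in_set_conv_nth)
  then show ?thesis using tails_inj[OF assms(1,2), of i j] tl_walk_nth assms(1,2) by simp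
qed

text \<open>Dropping the starts shifts all beads by \<open>succ\<close>, which permutes
  them.\<close>

lemma set_tl_walk: "\<Union>((\<lambda>p. set (tl (walk p))) ` \<P>) = beads"
proof -
  have "set (tl (walk p)) = {succ (walk p ! j) | j. j < 4 * n + 2}" if "p \<in> \<P>" for p
    unfolding set_conv_nth using length_walk[OF that] succ_bead[OF that] tl_walk_nth[OF that]
    by (intro Collect_cong iff_exI) auto
  then have "\<Union>((\<lambda>p. set (tl (walk p))) ` \<P>) = succ ` beads" unfolding beads_def by blast
  then show ?thesis by (simp only: succ_surj)
qed

lemma distinct_new_path: "p \<in> \<P> \<Longrightarrow> distinct (new_path p)"
  using distinct_tl_walk by (auto simp: new_path_def distinct_map inj_on_def)

lemma disjoint_new_paths:
  assumes "p \<in> \<P>" "q \<in> \<P>" "x \<in> set (new_path p)" "x \<in> set (new_path q)"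
  shows "p = q"
  using assms(3,4) second_inj[OF assms(1,2)] disjoint_tl_walk[OF assms(1,2)]
  by (auto simp: new_path_def)

lemma new_path_steps:
  assumes p: "p \<in> \<P>"
  shows "successively (\<lambda>x y. hamming x y = 1) (new_path p)"
proof -
  obtain r where r: "tl (walk p) = (p ! 1 @ [False]) # r" using tl_walk[OF p] .
  have "length x = 2 * n + 1" if "x \<in> set (tl (walk p))" for x
    using set_tl_walk p that beads_eq by (auto simp: cube_vertices_def layer_iff)
  moreover have "successively (\<lambda>x y. hamming x y = 1) (tl (walk p))"
    using walk_steps[OF p] by (cases "walk p") (auto simp: successively_Cons)
  ultimately have "successively (\<lambda>x y. hamming x y = 1) (map (\<lambda>x. x @ [True]) (tl (walk p)))"
    using successively_append_word by blast
  then show ?thesis by (simp add: new_path_def r successively_Cons hamming_append)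
qed

lemma build_factor_minus_eq: "build_factor_minus a \<P> = (\<Union>p\<in>\<P>. path_edges (tl (walk p)))"
proof -
  have "{{hd p @ [False], p ! 1 @ [False]} | p. p \<in> \<P>} = {{walk p ! 0, walk p ! Suc 0} | p. p \<in> \<P>}"
    by (intro Collect_cong iff_exI) (auto simp: walk_0 walk_1)
  moreover have "path_edges (tl (walk p)) = {{walk p ! Suc j, walk p ! Suc (Suc j)} | j. Suc j < 4 * n + 2}"
    if "p \<in> \<P>" for p
    unfolding path_edges_def using length_walk[OF that] tl_walk_nth[OF that]
    by (intro Collect_cong iff_exI) auto
  then have "(\<Union>p\<in>\<P>. path_edges (tl (walk p))) =
      {{walk p ! Suc j, walk p ! Suc (Suc j)} | p j. p \<in> \<P> \<and> Suc j < 4 * n + 2}" by blast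
  ultimately show ?thesis
    unfolding build_factor_minus_def build_factor_eq using edges_minus_first by simp
qed

lemma new_path_edges:
  "{{s @ [False, False], s @ [False, True]} | s. s \<in> seconds \<P>} \<union>
    append_edges (build_factor_minus a \<P>) [True] = \<Union> (path_edges ` new_path ` \<P>)"
proof -
  have "path_edges (new_path p) = insert {p ! 1 @ [False, False], p ! 1 @ [False, True]}
      ((`) (\<lambda>x. x @ [True]) ` path_edges (tl (walk p)))" if "p \<in> \<P>" for p
    unfolding path_edges_map[symmetric] by (rule tl_walk[OF that]) (simp add: new_path_def)
  then have "\<Union> (path_edges ` new_path ` \<P>) =
      (\<Union>p\<in>\<P>. insert {p ! 1 @ [False, False], p ! 1 @ [False, True]}
        ((`) (\<lambda>x. x @ [True]) ` path_edges (tl (walk p))))" by simp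
  moreover have "{{s @ [False, False], s @ [False, True]} | s. s \<in> seconds \<P>} =
      (\<Union>p\<in>\<P>. {{p ! 1 @ [False, False], p ! 1 @ [False, True]}})"
    by (auto simp: seconds_def)
  moreover have "append_edges (build_factor_minus a \<P>) [True] =
      (\<Union>p\<in>\<P>. (`) (\<lambda>x. x @ [True]) ` path_edges (tl (walk p)))"
    by (simp add: build_factor_minus_eq append_edges_def append_vertex_def[abs_def] image_UN)
  moreover have "(\<Union>p\<in>\<P>. {f p}) \<union> (\<Union>p\<in>\<P>. g p) = (\<Union>p\<in>\<P>. insert (f p) (g p))"
    for f :: "bitstring list \<Rightarrow> bitstring set" and g
    by blast
  ultimately show ?thesis by simp
qed

text \<open>The new paths are disjoint and thus are the components of their union; the prescribed
  first edge fixes the orientation.\<close>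

lemma build_new_paths_eq: "build_new_paths a \<P> = new_path ` \<P>"
proof -
  have comp: "components (\<Union> (path_edges ` new_path ` \<P>)) = path_edges ` new_path ` \<P>"
  proof (rule components_paths)
    show "p = q" if "p \<in> new_path ` \<P>" "q \<in> new_path ` \<P>" "set p \<inter> set q \<noteq> {}" for p q
      using that disjoint_new_paths by blast
  qed (auto simp: length_new_path)
  show ?thesis
  proof (intro equalityI subsetI)
    fix p assume "p \<in> build_new_paths a \<P>"
    then obtain q s where p: "distinct p" "2 \<le> length p" and q: "q \<in> \<P>" "path_edges p = path_edges (new_path q)"
      and s: "s \<in> seconds \<P>" "p ! 0 = s @ [False, False]"
      unfolding build_new_paths_def new_path_edges comp by auto
    have "set p = set (new_path q)"
      using Union_path_edges[of p] Union_path_edges[of "new_path q"] p q length_new_path by simp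
    then have "p ! 0 \<in> set (new_path q)" using p(2) nth_mem[of 0 p] by fastforce
    \<comment> \<open>All vertices of \<open>new_path q\<close> except the first end in
      \<open>True\<close>, while \<open>p ! 0\<close> ends in \<open>[False, False]\<close>.\<close>
    then have hd: "hd p = hd (new_path q)"
      using s p(2) by (cases p) (auto simp: new_path_def)
    have "p = new_path q"
    proof (rule path_edges_inj)
      show "p \<noteq> []" using p(2) by auto
      show "new_path q \<noteq> []" by (simp add: new_path_def)
    qed (use p q hd distinct_new_path in auto)
    then show "p \<in> new_path ` \<P>" using q by blast
  next
    fix p assume "p \<in> new_path ` \<P>"
    then obtain q where q: "q \<in> \<P>" "p = new_path q" by blast
    then show "p \<in> build_new_paths a \<P>"
      unfolding build_new_paths_def new_path_edges comp
      using distinct_new_path[of q] length_new_path[of q] new_path_1[of q]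
      by (auto simp: seconds_def)
  qed
qed

lemma new_paths_cover:
  "\<Union>(set ` new_path ` \<P>) = (\<lambda>x. x @ [False, False]) ` positive n (n + 1) \<union>
    (\<lambda>x. x @ [True]) ` cube_vertices (2 * n + 1) n"
proof -
  have "\<Union>(set ` new_path ` \<P>) = (\<lambda>x. x @ [False, False]) ` seconds \<P> \<union>
      (\<lambda>x. x @ [True]) ` \<Union>((\<lambda>p. set (tl (walk p))) ` \<P>)"
    by (auto simp: new_path_def seconds_def)
  then show ?thesis unfolding set_tl_walk beads_eq seconds_eq .
qed

lemma path_family_middle:
  assumes "path_family n (n + 1) \<Q>"
  shows "path_family (Suc n) (Suc n)
    (append_paths \<Q> [False, False] \<union> append_paths \<P> [True, False] \<union> build_new_paths a \<P>)"
    (is "path_family _ _ (?A \<union> ?B \<union> _)")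
proof -
  interpret Q: path_family n "n + 1" \<Q> by fact
  have partners: "(\<lambda>p. map_f a (hd (partner p))) ` \<P> = nonneg_touching n n"
    unfolding firsts_eq[symmetric]
    using partner_surj map_f_firsts_surj unfolding firsts_def by (metis image_image)
  have AB: "x \<in> set p \<Longrightarrow> x \<in> set q \<Longrightarrow> False" if "p \<in> ?A" "q \<in> ?B" for p q x
    using append_paths_vertex[OF that(1)] append_paths_vertex[OF that(2)] by fastforce
  have AN: "x \<in> set p \<Longrightarrow> x \<in> set q \<Longrightarrow> False" if "p \<in> ?A" "q \<in> new_path ` \<P>" for p q x
  proof -
    assume x: "x \<in> set p" "x \<in> set q"
    with that have "x \<in> (\<lambda>x. x @ [False, False]) ` covered n (n + 1)"
      using Q.cover_append[of "[False, False]"] by blast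
    moreover have "x \<in> (\<lambda>x. x @ [False, False]) ` positive n (n + 1) \<union>
        (\<lambda>x. x @ [True]) ` cube_vertices (2 * n + 1) n"
      using x that new_paths_cover by blast
    \<comment> \<open>\<open>covered n (n + 1)\<close> omits precisely the positive words at which
      the new paths start.\<close>
    ultimately show False by (auto simp: covered_def positive_def layer_iff)
  qed
  have BN: "x \<in> set p \<Longrightarrow> x \<in> set q \<Longrightarrow> False" if "p \<in> ?B" "q \<in> new_path ` \<P>" for p q x
    using append_paths_vertex[OF that(1), of x] that(2) by (auto simp: new_path_def)
  show ?thesis
    unfolding build_new_paths_eq
  proof
    fix p assume p: "p \<in> ?A \<union> ?B \<union> new_path ` \<P>"
    show "distinct p"
      using p Q.append_paths_family(1) append_paths_family(1) distinct_new_path by blast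
    show "successively (\<lambda>x y. hamming x y = 1) p"
      using p Q.append_paths_family(2) append_paths_family(2) new_path_steps by blast
    show "\<exists>j. flaws (last p) = {j} \<and> length p = 4 * j + 3"
    proof -
      consider "p \<in> ?A" | "p \<in> ?B" | q where "q \<in> \<P>" "p = new_path q" using p by blast
      then show ?thesis
      proof cases
        case 1
        then show ?thesis by (rule Q.append_paths_family(3)) simp
      next
        case 2
        then show ?thesis by (rule append_paths_family(3)) simp
      next
        case 3
        then have "map_f a (hd (partner q)) \<in> nonneg_touching n n" using partners by blast
        \<comment> \<open>A flawless word at height 0 goes down next. This is the flaw
          \<open>n\<close>, which matches the \<open>4 * n + 3\<close> vertices of a new
          path.\<close>
        then have "flaws (last p) = {n}"
          unfolding 3(2) last_new_path[OF 3(1)]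
          by (auto simp: nonneg_touching_def layer_iff flaws_append)
        with 3 show ?thesis using length_new_path by blast
      qed
    qed
  next
    fix p q x
    assume *: "p \<in> ?A \<union> ?B \<union> new_path ` \<P>" "q \<in> ?A \<union> ?B \<union> new_path ` \<P>" "x \<in> set p" "x \<in> set q"
    consider "p \<in> ?A" "q \<in> ?A" | "p \<in> ?B" "q \<in> ?B" | "p \<in> new_path ` \<P>" "q \<in> new_path ` \<P>"
      using * AB AN BN by blast
    then show "p = q"
    proof cases
      case 1 then show ?thesis using * Q.append_paths_disjoint by blast
    next
      case 2 then show ?thesis using * append_paths_disjoint by blast
    next
      case 3 then show ?thesis using * disjoint_new_paths by blast
    qed
  next
    show "\<Union>(set ` (?A \<union> ?B \<union> new_path ` \<P>)) = covered (Suc n) (Suc n)"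
      unfolding covered_middle[OF n_pos] image_Un Union_Un_distrib Q.cover_append cover_append new_paths_cover
      by (simp only: Un_assoc)
    have "firsts (?A \<union> ?B \<union> new_path ` \<P>) = firsts ?A \<union> firsts ?B \<union> (\<lambda>x. x @ [False, False]) ` seconds \<P>"
      by (simp add: firsts_def seconds_def image_Un image_image)
    then show "firsts (?A \<union> ?B \<union> new_path ` \<P>) = nonneg_touching (Suc n) (Suc n)"
      unfolding nonneg_touching_middle[OF n_pos] Q.firsts_append firsts_append seconds_eq by blast
    have "seconds (new_path ` \<P>) = (\<lambda>x. x @ [False, True]) ` seconds \<P>"
      using new_path_1 by (simp add: seconds_def image_image)
    then have "seconds (?A \<union> ?B \<union> new_path ` \<P>) = seconds ?A \<union> seconds ?B \<union> (\<lambda>x. x @ [False, True]) ` seconds \<P>"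
      by (simp add: seconds_def image_Un)
    then show "seconds (?A \<union> ?B \<union> new_path ` \<P>) = positive (Suc n) (Suc n + 1)"
      unfolding positive_middle[OF n_pos] Q.seconds_append seconds_append seconds_eq by simp
    have "lasts (new_path ` \<P>) = (\<lambda>x. x @ [False, True]) ` nonneg_touching n n"
      unfolding partners[symmetric] by (simp add: lasts_def image_image last_new_path)
    then have "lasts (?A \<union> ?B \<union> new_path ` \<P>) =
        lasts ?A \<union> lasts ?B \<union> (\<lambda>x. x @ [False, True]) ` nonneg_touching n n"
      by (simp add: lasts_def image_Un)
    then show "lasts (?A \<union> ?B \<union> new_path ` \<P>) = one_flaw (Suc n) (Suc n)"
      unfolding one_flaw_middle[OF n_pos] Q.lasts_append lasts_append .
  qed
qed

end

section \<open>The recursion\<close>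

lemma path_family_upper:
  assumes n: "1 \<le> n" and k: "n + 2 \<le> k"
    and "path_family n k \<P>" "path_family n (k - 1) \<Q>" "path_family n (k - 2) \<R>"
  shows "path_family (Suc n) k
    (append_paths \<P> [False, False] \<union> append_paths \<Q> [True, False] \<union>
     append_paths \<Q> [False, True] \<union> append_paths \<R> [True, True])"
    (is "path_family _ _ (?A \<union> ?B \<union> ?C \<union> ?D)")
proof -
  interpret P: path_family n k \<P> by fact
  interpret Q: path_family n "k - 1" \<Q> by fact
  interpret R: path_family n "k - 2" \<R> by fact
  show ?thesis
  proof
    fix p assume p: "p \<in> ?A \<union> ?B \<union> ?C \<union> ?D"
    show "distinct p"
      using p P.append_paths_family(1) Q.append_paths_family(1) R.append_paths_family(1) by blast
    show "successively (\<lambda>x y. hamming x y = 1) p"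
      using p P.append_paths_family(2) Q.append_paths_family(2) R.append_paths_family(2) by blast
    \<comment> \<open>The conditions under which the appended bits add no flaw; at level
      \<open>k - 2\<close> the first appended bit must be \<open>True\<close>.\<close>
    have "n < k + of_bool False" "n < k - 1 + of_bool b" "n < k - 2 + of_bool True" for b
      using k by auto
    then show "\<exists>j. flaws (last p) = {j} \<and> length p = 4 * j + 3"
      using p P.append_paths_family(3) Q.append_paths_family(3) R.append_paths_family(3) by blast
  next
    fix p q x
    assume *: "p \<in> ?A \<union> ?B \<union> ?C \<union> ?D" "q \<in> ?A \<union> ?B \<union> ?C \<union> ?D" "x \<in> set p" "x \<in> set q"
    have suffix: "drop (length x - 2) x = y" if "r \<in> append_paths \<X> y" "x \<in> set r" "length y = 2" for r \<X> y
      using append_paths_vertex[OF that(1,2)] that(3) by auto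
    have "p \<in> ?A \<and> q \<in> ?A \<or> p \<in> ?B \<and> q \<in> ?B \<or> p \<in> ?C \<and> q \<in> ?C \<or> p \<in> ?D \<and> q \<in> ?D"
      using * suffix[of p] suffix[of q] by fastforce
    then show "p = q"
      using * P.append_paths_disjoint Q.append_paths_disjoint R.append_paths_disjoint by blast
  next
    show "\<Union>(set ` (?A \<union> ?B \<union> ?C \<union> ?D)) = covered (Suc n) k"
      unfolding covered_upper[OF n k] image_Un Union_Un_distrib P.cover_append Q.cover_append R.cover_append ..
    show "firsts (?A \<union> ?B \<union> ?C \<union> ?D) = nonneg_touching (Suc n) k"
      unfolding nonneg_touching_upper[OF n k] P.firsts_append[symmetric] Q.firsts_append[symmetric]
        R.firsts_append[symmetric] by (simp add: firsts_def image_Un)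
    \<comment> \<open>Second vertices lie in the layer above, so \<open>positive_upper\<close> is
      used with \<open>k + 1\<close>.\<close>
    have "n + 2 \<le> k + 1" "k + 1 - 1 = k - 1 + 1" "k + 1 - 2 = k - 2 + 1" using k by auto
    then show "seconds (?A \<union> ?B \<union> ?C \<union> ?D) = positive (Suc n) (k + 1)"
      using positive_upper[OF n, of "k + 1"] P.seconds_append Q.seconds_append R.seconds_append
      by (simp only: seconds_def image_Un)
    show "lasts (?A \<union> ?B \<union> ?C \<union> ?D) = one_flaw (Suc n) k"
      unfolding one_flaw_upper[OF n k] P.lasts_append[symmetric] Q.lasts_append[symmetric]
        R.lasts_append[symmetric] by (simp add: lasts_def image_Un)
  qed
qed

lemma paths_empty: "2 * n \<le> k \<Longrightarrow> paths \<alpha> n k = {}"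
  by (cases "(\<alpha>, n, k)" rule: paths.cases) auto

text \<open>For \<open>2 \<le> k\<close> the family and the corresponding classes are all empty, so
  the induction can start at every level.\<close>

lemma path_family_base:
  assumes "1 \<le> k"
  shows "path_family 1 k (paths \<alpha> 1 k)"
proof -
  have flaws: "flaws [b, c] = (if b then {} else {0})" for b c
    using flaws_append[of "[]" 0 b c] by (auto simp: flaws_def)
  have touches: "touches [b, c] = (if b \<noteq> c then {1} else {})" for b c
    using touches_append[of "[]" 0 b c] by (auto simp: touches_def)

  have two: "length x = 2 \<longleftrightarrow>
      x = [True, True] \<or> x = [True, False] \<or> x = [False, True] \<or> x = [False, False]" for x :: bitstring
    by (auto simp: numeral_2_eq_2 length_Suc_conv)
  have sets: "nonneg_touching 1 k = (if k = 1 then {[True, False]} else {})"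
    "positive 1 (k + 1) = (if k = 1 then {[True, True]} else {})"
    "one_flaw 1 k = (if k = 1 then {[False, True]} else {})"
    "covered 1 k = (if k = 1 then {[True, False], [True, True], [False, True]} else {})"
    using assms
    by (auto simp: word_set_defs two flaws touches)
  have paths: "paths \<alpha> 1 k = (if k = 1 then {[[True, False], [True, True], [False, True]]} else {})"
    by simp
  show ?thesis
    unfolding path_family_def sets paths by (auto simp: firsts_def seconds_def lasts_def flaws)
qed

text \<open>All levels \<open>n \<le> k\<close> are treated together, including the empty ones from
  \<open>2 * n\<close> on, because the recursion draws on neighbouring levels.\<close>

lemma path_family_paths:
  "\<lbrakk>1 \<le> n; n \<le> k\<rbrakk> \<Longrightarrow> path_family n k (paths \<alpha> n k)"
proof (induction n arbitrary: k rule: nat_induct_at_least)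
  case base
  then show ?case by (rule path_family_base)
next
  case (Suc n)
  then obtain m where m: "n = Suc m" by (cases n) auto
  show ?case
  proof (cases "k = Suc n")
    case True
    interpret middle_family n "paths \<alpha> n n" "\<alpha> (2 * n)"
      using Suc by (simp add: middle_family_def middle_family_axioms_def)
    show ?thesis using path_family_middle[OF Suc.IH[of "n + 1"]] True m by simp
  next
    case False
    with Suc.prems have k: "n + 2 \<le> k" by simp
    have "paths \<alpha> (Suc n) k =
      append_paths (paths \<alpha> n k) [False, False] \<union> append_paths (paths \<alpha> n (k - 1)) [True, False] \<union>
      append_paths (paths \<alpha> n (k - 1)) [False, True] \<union> append_paths (paths \<alpha> n (k - 2)) [True, True]"
    proof (cases "k \<le> 2 * n + 1")
      case True
      then show ?thesis using k m by simp
    next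
      case False
      \<comment> \<open>From \<open>k = 2 * n + 2\<close> on both sides are empty, as even
        \<open>k - 2\<close> is at least \<open>2 * n\<close>.\<close>
      then show ?thesis using paths_empty[of n k] paths_empty[of n "k - 1"] paths_empty[of n "k - 2"]
        paths_empty[of "Suc n" k] by (simp add: append_paths_def)
    qed
    with path_family_upper[OF Suc.hyps k Suc.IH Suc.IH Suc.IH] k show ?thesis by simp
  qed
qed

theorem theorem10:
  fixes n :: nat and \<alpha> :: "nat \<Rightarrow> bool list"
  assumes "1 \<le> n"
    and "\<And>i. 1 \<le> i \<Longrightarrow> i \<le> n \<Longrightarrow> length (\<alpha> (2 * i)) = i - 1"
  shows "two_factor (cube_vertices (2 * n + 1) n) (cube_edges (2 * n + 1) n) (factor \<alpha> n) \<and>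
    (\<forall>C \<in> cycles (factor \<alpha> n). \<forall>c i d. traverses c C \<longrightarrow>
       next_at_distance {hd p @ [False] | p. p \<in> paths \<alpha> n n} c i d \<longrightarrow> d = 4 * n + 2) \<and>
    (\<forall>C \<in> cycles (factor \<alpha> n).
       card C = (4 * n + 2) * card {p \<in> paths \<alpha> n n. hd p @ [False] \<in> \<Union>C}) \<and>
    (\<forall>C \<in> cycles (factor \<alpha> n). (4 * n + 2) dvd card C) \<and>
    (\<forall>C. is_arg_min card (\<lambda>D. D \<in> cycles (factor \<alpha> n)) C \<longrightarrow> 4 * n + 2 \<le> card C)"
proof -
  interpret middle_family n "paths \<alpha> n n" "\<alpha> (2 * n)"
    using assms(1) path_family_paths[of n n] by (simp add: middle_family_def middle_family_axioms_def)
  have factor: "factor \<alpha> n = edges" by (simp only: factor_def build_factor_eq)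
  \<comment> \<open>The starts of the strings are the marked vertices, so distances and counts
    transfer from the general graph.\<close>
  have heads: "{walk p ! 0 | p. p \<in> paths \<alpha> n n} = {hd p @ [False] | p. p \<in> paths \<alpha> n n}"
    by (intro Collect_cong iff_exI) (auto simp: walk_0)
  have two: "two_factor (cube_vertices (2 * n + 1) n) (cube_edges (2 * n + 1) n) edges"
    unfolding two_factor_def beads_eq[symmetric] using edges_subset degree_two by blast
  have dist: "d = 4 * n + 2"
    if "C \<in> cycles edges" "traverses c C" "next_at_distance {hd p @ [False] | p. p \<in> paths \<alpha> n n} c i d" for C c i d
    using distance_eq[of c C i d] that unfolding heads by (simp add: cycles_def)
  have card: "card C = (4 * n + 2) * card {p \<in> paths \<alpha> n n. hd p @ [False] \<in> \<Union>C}" and pos: "0 < card C"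
    if "C \<in> cycles edges" for C
  proof -
    from that obtain c where c: "traverses c C" "C \<subseteq> edges" by (auto simp: cycles_def)
    have "{p \<in> paths \<alpha> n n. walk p ! 0 \<in> \<Union>C} = {p \<in> paths \<alpha> n n. hd p @ [False] \<in> \<Union>C}"
      using walk_0 by auto
    with card_cycle[OF c] show "card C = (4 * n + 2) * card {p \<in> paths \<alpha> n n. hd p @ [False] \<in> \<Union>C}"
      by simp
    show "0 < card C" using cycle_pos[OF c] .
  qed
  have dvd: "4 * n + 2 dvd card C" if "C \<in> cycles edges" for C
    unfolding card[OF that] by (rule dvd_triv_left)
  \<comment> \<open>A cycle has at least one edge, so divisibility gives the lower bound.\<close>
  moreover have "4 * n + 2 \<le> card C" if "is_arg_min card (\<lambda>D. D \<in> cycles edges) C" for C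
    using that dvd_imp_le[OF dvd pos] by (simp add: is_arg_min_def)
  ultimately show ?thesis unfolding factor using two dist card by blast
qed

end
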